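(* Let $\mathbf{P}\in\mathcal{M}$, $\boldsymbol{\eta}_{\mathbf{P}},\boldsymbol{\xi}_{\mathbf{P}}\in T_{\mathbf{P}}\mathcal{M}$, and $\mathbf{P}^{\mathrm{new}}=R^{\mathcal{M}}_{\mathbf{P}}(\boldsymbol{\eta}_{\mathbf{P}})$. Then a vector transport on $\mathcal{M}$ (associated with the retraction $R^{\mathcal{M}}$) is given by the orthogonal projection of $\boldsymbol{\xi}_{\mathbf{P}}$ onto $T_{\mathbf{P}^{\mathrm{new}}}\mathcal{M}$, namely $$\mathcal{T}^{\mathcal{M}}_{\boldsymbol{\eta}_{\mathbf{P}}}(\boldsymbol{\xi}_{\mathbf{P}})=\boldsymbol{\Pi}^{T_{\mathbf{P}}\mathcal{M}}_{T_{\mathbf{P}^{\mathrm{new}}}\mathcal{M}}(\boldsymbol{\xi}_{\mathbf{P}})=\Big(\boldsymbol{\xi}_{\mathbf{P}_1}-\sum_{\ell\in\mathcal{B}_1}\rho_\ell\mathbf{W}_1^H\mathbf{Q}_\ell\mathbf{W}_1\mathbf{P}^{\mathrm{new}}_1,\ \cdots,\ \boldsymbol{\xi}_{\mathbf{P}_U}-\sum_{\ell\in\mathcal{B}_U}\rho_\ell\mathbf{W}_U^H\mathbf{Q}_\ell\mathbf{W}_U\mathbf{P}^{\mathrm{new}}_U\Big),$$ where $$\rho_\ell=\frac{1}{P_\ell}\sum_{i\in\mathcal{U}_\ell}\Re\left\{\mathrm{tr}\left((\mathbf{P}^{\mathrm{new}}_i)^H\mathbf{W}_i^H\mathbf{Q}_\ell\mathbf{W}_i\boldsymbol{\xi}_{\mathbf{P}_i}\right)\right\},\qquad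 \ell\in\{1,\dots,B\}.$$
   Context: Let $B,U,M_t$ and $d_1,\dots,d_U$ be positive integers. For each $i\in\{1,\dots,U\}$, $\mathcal{B}_i=\{i_1,\dots,i_{B_i}\}\subseteq\{1,\dots,B\}$ is a nonempty set with $B_i$ (distinct) elements. For each $k\in\{1,\dots,B\}$, $\mathcal{U}_k=\{i\in\{1,\dots,U\}: k\in\mathcal{B}_i\}$. The numbers $P_k>0$, $k\in\{1,\dots,B\}$, are given. $\mathcal{N}=\mathcal{N}_1\times\cdots\times\mathcal{N}_U$ with $\mathcal{N}_i=\mathbb{C}^{B_iM_t\times d_i}$, regarded as a real linear manifold, so $T_{\mathbf{P}}\mathcal{N}=\mathcal{N}$ for every $\mathbf{P}$. A point is $\mathbf{P}=(\mathbf{P}_1,\dots,\mathbf{P}_U)$ with $\mathbf{P}_i=[\mathbf{P}_{i,i_1}^T,\dots,\mathbf{P}_{i,i_{B_i}}^T]^T$, $\mathbf{P}_{i,k}\in\mathbb{C}^{M_t\times d_i}$. The Riemannian metric on $\mathcal{N}$ is $g^{\mathcal{N}}_{\mathbf{P}}(\boldsymbol{\xi}_{\mathbf{P}},\boldsymbol{\zeta}_{\mathbf{P}})=\sum_{i=1}^{U}\Re\{\mathrm{tr}(\boldsymbol{\zeta}_{\mathbf{P}_i}^H\boldsymbol{\xi}_{\mathbf{P}_i})\}$. $\mathbf{W}_i\in\mathbb{R}^{BM_t\times B_iM_t}$ is the block matrix made of $B\times B_i$ blocks of size $M_t\times M_t$ whose $(i_n,n)$ block is $\mathbf{I}_{M_t}$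 for $n=1,\dots,B_i$ and whose other blocks are zero. $\mathbf{Q}_k\in\mathbb{C}^{BM_t\times BM_t}$ is the block diagonal matrix with $B$ diagonal blocks of size $M_t\times M_t$, whose $k$-th diagonal block is $\mathbf{I}_{M_t}$ and whose other blocks are zero. $\mathcal{M}$ is the Riemannian submanifold of $\mathcal{N}$ (with the induced metric) given by $$\mathcal{M}=\Big\{\mathbf{P}\in\mathcal{N}\ \Big|\ \sum_{i\in\mathcal{U}_k}\mathrm{tr}(\mathbf{P}_i^H\mathbf{W}_i^H\mathbf{Q}_k\mathbf{W}_i\mathbf{P}_i)=P_k,\ k=1,\dots,B\Big\},$$ whose tangent space at $\mathbf{P}\in\mathcal{M}$ is $$T_{\mathbf{P}}\mathcal{M}=\Big\{\boldsymbol{\xi}_{\mathbf{P}}\in T_{\mathbf{P}}\mathcal{N}\ \Big|\ \sum_{i\in\mathcal{U}_k}\mathrm{tr}\big(\boldsymbol{\xi}_{\mathbf{P}_i}^H\mathbf{W}_i^H\mathbf{Q}_k\mathbf{W}_i\mathbf{P}_i+\mathbf{P}_i^H\mathbf{W}_i^H\mathbf{Q}_k\mathbf{W}_i\boldsymbol{\xi}_{\mathbf{P}_i}\big)=0,\ k=1,\dots,B\Big\}.$$ The retraction $R^{\mathcal{M}}$ on $\mathcal{M}$ is $R^{\mathcal{M}}_{\mathbf{P}}(\boldsymbol{\xi}_{\mathbf{P}})=(\boldsymbol{\Gamma}_1(\mathbf{P}_1+\boldsymbol{\xi}_{\mathbf{P}_1}),\dots,\boldsymbol{\Gamma}_U(\mathbf{P}_U+\boldsymbol{\xi}_{\mathbf{P}_U}))$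 for $\boldsymbol{\xi}_{\mathbf{P}}\in T_{\mathbf{P}}\mathcal{M}$, where $\boldsymbol{\Gamma}_i=\mathrm{blkdiag}(\gamma_{i_1}\mathbf{I}_{M_t},\dots,\gamma_{i_{B_i}}\mathbf{I}_{M_t})$ and $\gamma_k=\sqrt{P_k}\big/\sqrt{\sum_{i\in\mathcal{U}_k}\mathrm{tr}((\mathbf{P}_i+\boldsymbol{\xi}_{\mathbf{P}_i})^H\mathbf{W}_i^H\mathbf{Q}_k\mathbf{W}_i(\mathbf{P}_i+\boldsymbol{\xi}_{\mathbf{P}_i}))}$. Since all tangent spaces of $\mathcal{N}$ are identified with $\mathcal{N}$, a vector $\boldsymbol{\xi}_{\mathbf{P}}\in T_{\mathbf{P}}\mathcal{M}$ is also an element of $T_{\mathbf{P}^{\mathrm{new}}}\mathcal{N}$; $\boldsymbol{\Pi}^{T_{\mathbf{P}}\mathcal{M}}_{T_{\mathbf{P}^{\mathrm{new}}}\mathcal{M}}$ denotes the restriction to $T_{\mathbf{P}}\mathcal{M}$ of the orthogonal projection (with respect to $g^{\mathcal{N}}$) onto $T_{\mathbf{P}^{\mathrm{new}}}\mathcal{M}$. A vector transport on $\mathcal{M}$ associated with a retraction $R$ (in the standard sense of Absil–Mahony–Sepulchre) is a smooth mapping $(\boldsymbol{\eta}_{\mathbf{P}},\boldsymbol{\xi}_{\mathbf{P}})\mapsto\mathcal{T}_{\boldsymbol{\eta}_{\mathbf{P}}}(\boldsymbol{\xi}_{\mathbf{P}})$, defined for pairs of tangent vectors at a common point $\mathbf{P}\in\mathcal{M}$,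 such that $\mathcal{T}_{\boldsymbol{\eta}_{\mathbf{P}}}(\boldsymbol{\xi}_{\mathbf{P}})\in T_{R_{\mathbf{P}}(\boldsymbol{\eta}_{\mathbf{P}})}\mathcal{M}$, $\mathcal{T}_{\mathbf{0}}(\boldsymbol{\xi}_{\mathbf{P}})=\boldsymbol{\xi}_{\mathbf{P}}$, and $\mathcal{T}_{\boldsymbol{\eta}_{\mathbf{P}}}$ is linear in $\boldsymbol{\xi}_{\mathbf{P}}$. *)

theory Defs
  imports "HOL-Analysis.Analysis" "Jordan_Normal_Form.Schur_Decomposition"
begin

text \<open>
  Stations, users, blocks and matrix entries are all numbered from 0. The list serving s i
  enumerates the stations serving user i in the order of the blocks of the i-th matrix of a
  point; its length is the number of blocks.
\<close>

record mimo_system =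
  n_stations :: nat
  n_users :: nat
  n_antennas :: nat
  n_streams :: "nat \<Rightarrow> nat"
  serving :: "nat \<Rightarrow> nat list"
  tx_power :: "nat \<Rightarrow> real"

definition valid_system :: "mimo_system \<Rightarrow> bool" where
  "valid_system s \<longleftrightarrow>
     0 < n_stations s \<and> 0 < n_users s \<and> 0 < n_antennas s \<and>
     (\<forall>i<n_users s. 0 < n_streams s i) \<and>
     (\<forall>i<n_users s. serving s i \<noteq> [] \<and> distinct (serving s i) \<and>
                     set (serving s i) \<subseteq> {..<n_stations s}) \<and>
     (\<forall>k<n_stations s. 0 < tx_power s k)"

definition users_of :: "mimo_system \<Rightarrow> nat \<Rightarrow> nat set" where
  "users_of s k = {i. i < n_users s \<and> k \<in> set (serving s i)}"

definition n_rows :: "mimo_system \<Rightarrow> nat \<Rightarrow> nat" where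
  "n_rows s i = length (serving s i) * n_antennas s"

definition mat_trace :: "complex mat \<Rightarrow> complex" where
  "mat_trace A = (\<Sum>r<dim_row A. A $$ (r, r))"

text \<open>
  The entry (r, c) lies in block (r div M, c div M) at position (r mod M, c mod M),
  where M is the block size.
\<close>

definition W_mat :: "mimo_system \<Rightarrow> nat \<Rightarrow> complex mat" where
  "W_mat s i = mat (n_stations s * n_antennas s) (n_rows s i)
     (\<lambda>(r, c). if r div n_antennas s = serving s i ! (c div n_antennas s)
               then 1\<^sub>m (n_antennas s) $$ (r mod n_antennas s, c mod n_antennas s) else 0)"

definition Q_mat :: "mimo_system \<Rightarrow> nat \<Rightarrow> complex mat" where
  "Q_mat s k = diag_block_mat
     (map (\<lambda>j. if j = k then 1\<^sub>m (n_antennas s) else 0\<^sub>m (n_antennas s) (n_antennas s))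
        [0..<n_stations s])"

definition WQW :: "mimo_system \<Rightarrow> nat \<Rightarrow> nat \<Rightarrow> complex mat" where
  "WQW s i k = mat_adjoint (W_mat s i) * Q_mat s k * W_mat s i"

definition ambient :: "mimo_system \<Rightarrow> complex mat list set" where
  "ambient s = {X. length X = n_users s \<and>
                   (\<forall>i<n_users s. X ! i \<in> carrier_mat (n_rows s i) (n_streams s i))}"

definition tup_zero :: "mimo_system \<Rightarrow> complex mat list" where
  "tup_zero s = map (\<lambda>i. 0\<^sub>m (n_rows s i) (n_streams s i)) [0..<n_users s]"

definition tup_add :: "complex mat list \<Rightarrow> complex mat list \<Rightarrow> complex mat list" where
  "tup_add X Y = map2 (+) X Y"

definition tup_diff :: "complex mat list \<Rightarrow> complex mat list \<Rightarrow> complex mat list" where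
  "tup_diff X Y = map2 (-) X Y"

definition tup_scale :: "real \<Rightarrow> complex mat list \<Rightarrow> complex mat list" where
  "tup_scale a X = map (\<lambda>A. complex_of_real a \<cdot>\<^sub>m A) X"

definition riem_metric :: "mimo_system \<Rightarrow> complex mat list \<Rightarrow> complex mat list \<Rightarrow> real" where
  "riem_metric s \<xi> \<zeta> = (\<Sum>i<n_users s. Re (mat_trace (mat_adjoint (\<zeta> ! i) * \<xi> ! i)))"

definition orth_proj ::
  "mimo_system \<Rightarrow> complex mat list set \<Rightarrow> complex mat list \<Rightarrow> complex mat list" where
  "orth_proj s V x = (THE y. y \<in> V \<and> (\<forall>z\<in>V. riem_metric s (tup_diff x y) z = 0))"

definition manifold_M :: "mimo_system \<Rightarrow> complex mat list set" where
  "manifold_M s = {P \<in> ambient s. \<forall>k<n_stations s.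
     (\<Sum>i\<in>users_of s k. mat_trace (mat_adjoint (P ! i) * WQW s i k * P ! i))
       = complex_of_real (tx_power s k)}"

definition tangent :: "mimo_system \<Rightarrow> complex mat list \<Rightarrow> complex mat list set" where
  "tangent s P = {\<xi> \<in> ambient s. \<forall>k<n_stations s.
     (\<Sum>i\<in>users_of s k. mat_trace (mat_adjoint (\<xi> ! i) * WQW s i k * P ! i
                                  + mat_adjoint (P ! i) * WQW s i k * \<xi> ! i)) = 0}"

text \<open>
  The sum under the second root is a sum of squared absolute values, hence real; Re only
  converts its type.
\<close>

definition gamma_coeff ::
  "mimo_system \<Rightarrow> complex mat list \<Rightarrow> complex mat list \<Rightarrow> nat \<Rightarrow> real" where
  "gamma_coeff s P \<xi> k = sqrt (tx_power s k) /
     sqrt (Re (\<Sum>i\<in>users_of s k.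
       mat_trace (mat_adjoint (P ! i + \<xi> ! i) * WQW s i k * (P ! i + \<xi> ! i))))"

definition Gamma_mat ::
  "mimo_system \<Rightarrow> complex mat list \<Rightarrow> complex mat list \<Rightarrow> nat \<Rightarrow> complex mat" where
  "Gamma_mat s P \<xi> i = diag_block_mat
     (map (\<lambda>k. complex_of_real (gamma_coeff s P \<xi> k) \<cdot>\<^sub>m 1\<^sub>m (n_antennas s)) (serving s i))"

definition retr_M ::
  "mimo_system \<Rightarrow> complex mat list \<Rightarrow> complex mat list \<Rightarrow> complex mat list" where
  "retr_M s P \<xi> = map (\<lambda>i. Gamma_mat s P \<xi> i * (P ! i + \<xi> ! i)) [0..<n_users s]"

text \<open>
  A real-valued function of finitely many real coordinates, indexed by I, is of class C^k on
  an open set if its iterated partial derivatives up to order k exist and are continuous.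
\<close>

definition partial_deriv :: "'i \<Rightarrow> (('i \<Rightarrow> real) \<Rightarrow> real) \<Rightarrow> ('i \<Rightarrow> real) \<Rightarrow> real" where
  "partial_deriv j f x = deriv (\<lambda>t. f (x(j := t))) (x j)"

primrec Ck_on :: "nat \<Rightarrow> 'i set \<Rightarrow> ('i \<Rightarrow> real) set \<Rightarrow> (('i \<Rightarrow> real) \<Rightarrow> real) \<Rightarrow> bool" where
  "Ck_on 0 I D f \<longleftrightarrow> continuous_map (subtopology (powertop_real I) D) euclideanreal f"
| "Ck_on (Suc k) I D f \<longleftrightarrow>
     continuous_map (subtopology (powertop_real I) D) euclideanreal f \<and>
     (\<forall>j\<in>I. (\<forall>x\<in>D. (\<lambda>t. f (x(j := t))) field_differentiable at (x j)) \<and>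
             Ck_on k I D (partial_deriv j f))"

definition smooth_fun_on :: "'i set \<Rightarrow> ('i \<Rightarrow> real) set \<Rightarrow> (('i \<Rightarrow> real) \<Rightarrow> real) \<Rightarrow> bool" where
  "smooth_fun_on I D f \<longleftrightarrow> (\<forall>k. Ck_on k I D f)"

text \<open>
  Smoothness of F on a subset S of a space with global linear coordinates \<phi> (indexed by I),
  with values in a space with global linear coordinates \<psi> (indexed by J): near every point
  of S, the coordinates of F are restrictions of smooth functions on an open set of the
  coordinate space. If S is an embedded submanifold and F takes values in an embedded
  submanifold, this is smoothness of F as a map of manifolds.
\<close>

definition smooth_map ::
  "'i set \<Rightarrow> ('a \<Rightarrow> 'i \<Rightarrow> real) \<Rightarrow> 'j set \<Rightarrow> ('b \<Rightarrow> 'j \<Rightarrow> real) \<Rightarrow> 'a set \<Rightarrow> ('a \<Rightarrow> 'b) \<Rightarrow> bool" where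
  "smooth_map I \<phi> J \<psi> S F \<longleftrightarrow>
     (\<forall>p\<in>S. \<exists>D G. openin (powertop_real I) D \<and> \<phi> p \<in> D \<and>
        (\<forall>j\<in>J. smooth_fun_on I D (G j)) \<and>
        (\<forall>q\<in>S. \<phi> q \<in> D \<longrightarrow> (\<forall>j\<in>J. \<psi> (F q) j = G j (\<phi> q))))"

text \<open>
  (i, r, c, b) stands for the real (b false) or imaginary (b true) part of entry (r, c) of
  the i-th matrix.
\<close>

type_synonym coord_idx = "nat \<times> nat \<times> nat \<times> bool"

definition idx1 :: "mimo_system \<Rightarrow> coord_idx set" where
  "idx1 s = {(i, r, c, b). i < n_users s \<and> r < n_rows s i \<and> c < n_streams s i}"

definition coord1 :: "mimo_system \<Rightarrow> complex mat list \<Rightarrow> coord_idx \<Rightarrow> real" where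
  "coord1 s X =
     (\<lambda>(i, r, c, b)\<in>idx1 s. if b then Im (X ! i $$ (r, c)) else Re (X ! i $$ (r, c)))"

definition idx2 :: "mimo_system \<Rightarrow> (coord_idx + coord_idx) set" where
  "idx2 s = idx1 s <+> idx1 s"

definition coord2 ::
  "mimo_system \<Rightarrow> complex mat list \<times> complex mat list \<Rightarrow> coord_idx + coord_idx \<Rightarrow> real" where
  "coord2 s = (\<lambda>(X, Y). case_sum (coord1 s X) (coord1 s Y))"

definition idx3 :: "mimo_system \<Rightarrow> (coord_idx + coord_idx + coord_idx) set" where
  "idx3 s = idx1 s <+> idx2 s"

definition coord3 ::
  "mimo_system \<Rightarrow> complex mat list \<times> complex mat list \<times> complex mat list
     \<Rightarrow> coord_idx + coord_idx + coord_idx \<Rightarrow> real" where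
  "coord3 s = (\<lambda>(X, YZ). case_sum (coord1 s X) (coord2 s YZ))"

definition tangent_bundle :: "mimo_system \<Rightarrow> (complex mat list \<times> complex mat list) set" where
  "tangent_bundle s = (SIGMA P:manifold_M s. tangent s P)"

definition whitney_sum ::
  "mimo_system \<Rightarrow> (complex mat list \<times> complex mat list \<times> complex mat list) set" where
  "whitney_sum s = (SIGMA P:manifold_M s. tangent s P \<times> tangent s P)"

text \<open>
  The last clause says that the differential of R P at 0 is the identity of the tangent
  space at P, expressed through the curves t \<mapsto> R P (t \<xi>).
\<close>

definition is_retraction ::
  "mimo_system \<Rightarrow> (complex mat list \<Rightarrow> complex mat list \<Rightarrow> complex mat list) \<Rightarrow> bool" where
  "is_retraction s R \<longleftrightarrow>
     smooth_map (idx2 s) (coord2 s) (idx1 s) (coord1 s) (tangent_bundle s) (\<lambda>(P, \<xi>). R P \<xi>) \<and>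
     (\<forall>P\<in>manifold_M s.
        (\<forall>\<xi>\<in>tangent s P. R P \<xi> \<in> manifold_M s) \<and>
        R P (tup_zero s) = P \<and>
        (\<forall>\<xi>\<in>tangent s P. \<forall>i<n_users s. \<forall>r<n_rows s i. \<forall>c<n_streams s i.
           ((\<lambda>t. R P (tup_scale t \<xi>) ! i $$ (r, c)) has_vector_derivative \<xi> ! i $$ (r, c)) (at 0)))"

text \<open>
  T P \<eta> \<xi> is the transport of \<xi> along \<eta>, both tangent at P. As an element of the tangent
  bundle it is the pair of its foot point R P \<eta> and the vector T P \<eta> \<xi>.
\<close>

definition is_vector_transport ::
  "mimo_system \<Rightarrow> (complex mat list \<Rightarrow> complex mat list \<Rightarrow> complex mat list)
     \<Rightarrow> (complex mat list \<Rightarrow> complex mat list \<Rightarrow> complex mat list \<Rightarrow> complex mat list) \<Rightarrow> bool" where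
  "is_vector_transport s R T \<longleftrightarrow>
     is_retraction s R \<and>
     smooth_map (idx3 s) (coord3 s) (idx2 s) (coord2 s) (whitney_sum s)
       (\<lambda>(P, \<eta>, \<xi>). (R P \<eta>, T P \<eta> \<xi>)) \<and>
     (\<forall>P\<in>manifold_M s.
        (\<forall>\<eta>\<in>tangent s P. \<forall>\<xi>\<in>tangent s P. T P \<eta> \<xi> \<in> tangent s (R P \<eta>)) \<and>
        (\<forall>\<xi>\<in>tangent s P. T P (tup_zero s) \<xi> = \<xi>) \<and>
        (\<forall>\<eta>\<in>tangent s P. \<forall>\<xi>\<in>tangent s P. \<forall>\<zeta>\<in>tangent s P. \<forall>a b.
           T P \<eta> (tup_add (tup_scale a \<xi>) (tup_scale b \<zeta>)) =
             tup_add (tup_scale a (T P \<eta> \<xi>)) (tup_scale b (T P \<eta> \<zeta>))))"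

definition proj_transport ::
  "mimo_system \<Rightarrow> complex mat list \<Rightarrow> complex mat list \<Rightarrow> complex mat list \<Rightarrow> complex mat list" where
  "proj_transport s P \<eta> \<xi> = orth_proj s (tangent s (retr_M s P \<eta>)) \<xi>"

definition rho_coeff ::
  "mimo_system \<Rightarrow> complex mat list \<Rightarrow> complex mat list \<Rightarrow> nat \<Rightarrow> real" where
  "rho_coeff s X \<xi> l = 1 / tx_power s l *
     (\<Sum>i\<in>users_of s l. Re (mat_trace (mat_adjoint (X ! i) * WQW s i l * \<xi> ! i)))"

end

theory Submission
  imports Defs
begin

text \<open>
  The matrices WQW are diagonal 0/1 matrices, so in real coordinates each station k owns a set of
  coordinates, these sets partition the index set, and the k-th constraint says that the squared
  Euclidean norm of the k-th group of coordinates is tx_power s k. Thus the manifold is a product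
  of spheres, the retraction normalises each group, and the projection onto the tangent space at X
  subtracts from the k-th group of \<xi> the multiple rho_coeff s X \<xi> k of the k-th group of X. On the
  tangent bundle the group norms of P + \<eta> do not vanish, because \<eta> is orthogonal to P in each
  group. Smoothness holds because all coordinates of the maps lie in a class of functions, built
  from coordinates by ring operations and reciprocal square roots of positive members, that is
  closed under partial derivatives.
\<close>

section \<open>A class of functions stable under partial derivatives\<close>

section \<open>Smoothness\<close>

text \<open>The reciprocal root is a single generator because its derivative is -1/2 times its cube
  times the derivative of the radicand, again a product of members. Positivity of the radicand is
  asked on \<open>D\<close> only: the radicands that occur later are positive near the manifold data
  but can vanish elsewhere.\<close>

inductive_set smooth_alg :: "'i set \<Rightarrow> ('i \<Rightarrow> real) set \<Rightarrow> (('i \<Rightarrow> real) \<Rightarrow> real) set"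
  for I D where
  const: "(\<lambda>_. c) \<in> smooth_alg I D"
| proj: "j \<in> I \<Longrightarrow> (\<lambda>x. x j) \<in> smooth_alg I D"
| add: "f \<in> smooth_alg I D \<Longrightarrow> g \<in> smooth_alg I D \<Longrightarrow> (\<lambda>x. f x + g x) \<in> smooth_alg I D"
| mult: "f \<in> smooth_alg I D \<Longrightarrow> g \<in> smooth_alg I D \<Longrightarrow> (\<lambda>x. f x * g x) \<in> smooth_alg I D"
| rsqrt: "f \<in> smooth_alg I D \<Longrightarrow> (\<And>x. x \<in> D \<Longrightarrow> 0 < f x) \<Longrightarrow> (\<lambda>x. 1 / sqrt (f x)) \<in> smooth_alg I D"

lemma smooth_alg_sum:
  assumes "finite J" "\<And>j. j \<in> J \<Longrightarrow> f j \<in> smooth_alg I D"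
  shows "(\<lambda>x. \<Sum>j\<in>J. f j x) \<in> smooth_alg I D"
  using assms by (induction J) (auto intro: smooth_alg.intros)

lemma smooth_alg_diff:
  assumes "f \<in> smooth_alg I D" "g \<in> smooth_alg I D"
  shows "(\<lambda>x. f x - g x) \<in> smooth_alg I D"
proof -
  have "(\<lambda>x. f x + (-1) * g x) \<in> smooth_alg I D"
    by (intro smooth_alg.intros assms)
  then show ?thesis by simp
qed

lemma smooth_alg_continuous:
  assumes "f \<in> smooth_alg I D"
  shows "continuous_map (subtopology (powertop_real I) D) euclideanreal f"
  using assms
proof induction
  case (rsqrt f)
  have "continuous_map (subtopology (powertop_real I) D) euclideanreal (sqrt \<circ> f)"
    by (rule continuous_map_compose[OF rsqrt.IH]) (simp add: continuous_on_real_sqrt)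
  then show ?case
    using rsqrt.hyps(2) by (intro continuous_map_real_divide) (force simp: o_def)+
next
  case (proj j)
  then show ?case by (intro continuous_map_from_subtopology continuous_map_product_projection)
qed (auto intro: continuous_map_add continuous_map_real_mult)

text \<open>By induction along the generation of the class, following the sum, product and chain
  rules. The derivative is claimed at points of \<open>D\<close> only, where radicands are positive
  and reciprocal roots are differentiable.\<close>

lemma smooth_alg_partial:
  assumes "f \<in> smooth_alg I D" "j \<in> I"
  shows "\<exists>g\<in>smooth_alg I D. \<forall>x\<in>D. ((\<lambda>t. f (x(j := t))) has_real_derivative g x) (at (x j))"
  using assms(1)
proof induction
  case (const c)
  show ?case by (rule bexI[of _ "\<lambda>_. 0"]) (auto intro: smooth_alg.const)
next
  case (proj i)
  show ?case
    by (rule bexI[of _ "\<lambda>_. if i = j then 1 else 0"]) (auto intro: smooth_alg.const)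
next
  case (add f g)
  then obtain f' g' where *: "f' \<in> smooth_alg I D" "g' \<in> smooth_alg I D"
    and d: "\<And>x. x \<in> D \<Longrightarrow> ((\<lambda>t. f (x(j := t))) has_real_derivative f' x) (at (x j))"
      "\<And>x. x \<in> D \<Longrightarrow> ((\<lambda>t. g (x(j := t))) has_real_derivative g' x) (at (x j))"
    by blast
  show ?case
    by (rule bexI[OF _ smooth_alg.add[OF *]]) (intro ballI DERIV_add d)
next
  case (mult f g)
  then obtain f' g' where *: "f' \<in> smooth_alg I D" "g' \<in> smooth_alg I D"
    and d: "\<And>x. x \<in> D \<Longrightarrow> ((\<lambda>t. f (x(j := t))) has_real_derivative f' x) (at (x j))"
      "\<And>x. x \<in> D \<Longrightarrow> ((\<lambda>t. g (x(j := t))) has_real_derivative g' x) (at (x j))"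
    by blast
  show ?case
  proof (rule bexI[of _ "\<lambda>x. f' x * g x + g' x * f x"])
    show "(\<lambda>x. f' x * g x + g' x * f x) \<in> smooth_alg I D"
      by (intro smooth_alg.add smooth_alg.mult * mult.hyps)
    show "\<forall>x\<in>D. ((\<lambda>t. f (x(j := t)) * g (x(j := t))) has_real_derivative
        f' x * g x + g' x * f x) (at (x j))"
    proof
      fix x assume "x \<in> D"
      \<comment> \<open>The product rule evaluates the factors at \<open>x(j := x j)\<close>;
        keeping the update folded lets it collapse to \<open>x\<close>.\<close>
      from DERIV_mult[OF d(1)[OF this] d(2)[OF this]]
      show "((\<lambda>t. f (x(j := t)) * g (x(j := t))) has_real_derivative
          f' x * g x + g' x * f x) (at (x j))"
        by (simp del: fun_upd_apply)
    qed
  qed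
next
  case (rsqrt f)
  then obtain f' where f': "f' \<in> smooth_alg I D"
    and d: "\<And>x. x \<in> D \<Longrightarrow> ((\<lambda>t. f (x(j := t))) has_real_derivative f' x) (at (x j))"
    by blast
  let ?r = "\<lambda>x. 1 / sqrt (f x)"
  have r: "?r \<in> smooth_alg I D" using rsqrt.hyps by (rule smooth_alg.rsqrt)
  show ?case
  \<comment> \<open>This is d(f^(-1/2)) = -1/2 * f^(-3/2) * f', with the power -3/2 spelled out as
    three factors \<open>?r x\<close>.\<close>
  proof (rule bexI[of _ "\<lambda>x. (-1/2) * (?r x * (?r x * (?r x * f' x)))"])
    show "(\<lambda>x. (-1/2) * (?r x * (?r x * (?r x * f' x)))) \<in> smooth_alg I D"
      by (intro smooth_alg.mult smooth_alg.const r f')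
    show "\<forall>x\<in>D. ((\<lambda>t. ?r (x(j := t))) has_real_derivative
        (-1/2) * (?r x * (?r x * (?r x * f' x)))) (at (x j))"
    proof
      fix x assume x: "x \<in> D"
      have pos: "0 < f x" using rsqrt.hyps(2) x .
      show "((\<lambda>t. ?r (x(j := t))) has_real_derivative
        (-1/2) * (?r x * (?r x * (?r x * f' x)))) (at (x j))"
        using pos
        by (auto intro!: derivative_eq_intros d[OF x] simp: field_simps)
    qed
  qed
qed

lemma smooth_alg_smooth_fun_on:
  assumes "openin (powertop_real I) D" "f \<in> smooth_alg I D"
  shows "smooth_fun_on I D f"
proof -
  \<comment> \<open>Iterated partial derivatives agree with members of the class only on D, whence the
    generalisation to functions that do so.\<close>
  have "Ck_on k I D f" if "g \<in> smooth_alg I D" "\<And>x. x \<in> D \<Longrightarrow> f x = g x" for k f g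
    using that
  proof (induction k arbitrary: f g)
    case 0
    then show ?case
      using smooth_alg_continuous[OF 0(1)] by (auto intro: continuous_map_eq)
  next
    case (Suc k)
    have cont: "continuous_map (subtopology (powertop_real I) D) euclideanreal f"
      using smooth_alg_continuous[OF Suc.prems(1)] Suc.prems(2) by (auto intro: continuous_map_eq)
    have "(\<forall>x\<in>D. (\<lambda>t. f (x(j := t))) field_differentiable at (x j)) \<and> Ck_on k I D (partial_deriv j f)"
      if j: "j \<in> I" for j
    proof -
      obtain h where h: "h \<in> smooth_alg I D"
        and dg: "\<And>x. x \<in> D \<Longrightarrow> ((\<lambda>t. g (x(j := t))) has_real_derivative h x) (at (x j))"
        using smooth_alg_partial[OF Suc.prems(1) j] by blast
      have df: "((\<lambda>t. f (x(j := t))) has_real_derivative h x) (at (x j))" if x: "x \<in> D" for x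
      proof (rule has_field_derivative_transform_within_open[OF dg[OF x]])
        \<comment> \<open>Agreement of \<open>f\<close> and \<open>g\<close> on \<open>D\<close>
          passes to derivatives once \<open>x(j := t)\<close> stays in \<open>D\<close> for
          \<open>t\<close> near \<open>x j\<close>. The set of such \<open>t\<close> is the preimage
          of the open set \<open>D\<close> under the continuous line
          \<open>t \<mapsto> x(j := t)\<close>; this line runs inside the product space because
          \<open>x\<close> is extensional and \<open>j\<close> lies in \<open>I\<close>.\<close>
        have ext: "x \<in> extensional I"
          using assms(1) x openin_subset by (fastforce simp: PiE_def)
        have "continuous_map euclideanreal (powertop_real I) (\<lambda>t. x(j := t))"
          using ext j by (auto simp: continuous_map_componentwise extensional_def)
        then have "openin euclideanreal {t \<in> topspace euclideanreal. x(j := t) \<in> D}"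
          using assms(1) by (rule openin_continuous_map_preimage)
        then show "open {t. x(j := t) \<in> D}" by simp
        show "x j \<in> {t. x(j := t) \<in> D}" using x by simp
      qed (use Suc.prems(2) in \<open>simp del: fun_upd_apply\<close>)
      have "partial_deriv j f x = h x" if "x \<in> D" for x
        unfolding partial_deriv_def using df[OF that] by (rule DERIV_imp_deriv)
      then have "Ck_on k I D (partial_deriv j f)" by (rule Suc.IH[OF h])
      then show ?thesis using df by (auto simp: field_differentiable_def)
    qed
    then show ?case using cont by simp
  qed
  then show ?thesis using assms(2) by (auto simp: smooth_fun_on_def)
qed

lemma openin_positive_smooth_alg:
  assumes "finite K" "\<And>k. k \<in> K \<Longrightarrow> f k \<in> smooth_alg I UNIV"
  shows "openin (powertop_real I) {x \<in> topspace (powertop_real I). \<forall>k\<in>K. 0 < f k x}"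
  using assms
proof induction
  case empty
  have "{x \<in> topspace (powertop_real I). \<forall>k\<in>{}. 0 < f k x} = topspace (powertop_real I)" by blast
  then show ?case by (simp only: openin_topspace)
next
  case (insert k K)
  have "continuous_map (powertop_real I) euclideanreal (f k)"
    using smooth_alg_continuous[of "f k" I UNIV] insert.prems by simp
  then have "openin (powertop_real I) {x \<in> topspace (powertop_real I). f k x \<in> {0<..}}"
    by (rule openin_continuous_map_preimage) simp
  with insert have "openin (powertop_real I) ({x \<in> topspace (powertop_real I). f k x \<in> {0<..}} \<inter>
      {x \<in> topspace (powertop_real I). \<forall>k\<in>K. 0 < f k x})"
    by (intro openin_Int) auto
  then show ?case
    by (rule back_subst[of "openin _"]) auto
qed

section \<open>Block matrices\<close>

lemma mat_adjoint_carrier [simp]: "A \<in> carrier_mat n m \<Longrightarrow> mat_adjoint A \<in> carrier_mat m n"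
  for A :: "complex mat"
  by (auto simp: mat_adjoint_def mat_of_rows_def)

lemma dim_mat_adjoint [simp]:
  "dim_row (mat_adjoint A) = dim_col A" "dim_col (mat_adjoint A) = dim_row A"
  for A :: "complex mat"
  by (auto simp: mat_adjoint_def)

lemma index_mat_adjoint [simp]:
  "r < dim_col A \<Longrightarrow> c < dim_row A \<Longrightarrow> mat_adjoint A $$ (r, c) = cnj (A $$ (c, r))"
  for A :: "complex mat"
  by (auto simp: mat_adjoint_def mat_of_rows_def)

lemma index_mult_mat_sum:
  "r < dim_row A \<Longrightarrow> c < dim_col B \<Longrightarrow> dim_col A = n \<Longrightarrow> dim_row B = n \<Longrightarrow>
    (A * B) $$ (r, c) = (\<Sum>a<n. A $$ (r, a) * B $$ (a, c))"
  by (auto simp: scalar_prod_def atLeast0LessThan intro!: sum.cong)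

text \<open>The diagonal entries of the product are Hermitian products of columns; the sums are then
  exchanged so that rows come first, since stations own whole rows.\<close>

lemma mat_trace_adjoint_mult:
  assumes "A \<in> carrier_mat n d" "B \<in> carrier_mat n d"
  shows "mat_trace (mat_adjoint A * B) = (\<Sum>r<n. \<Sum>c<d. cnj (A $$ (r, c)) * B $$ (r, c))"
proof -
  have "mat_trace (mat_adjoint A * B) = (\<Sum>c<d. (mat_adjoint A * B) $$ (c, c))"
    using assms by (simp add: mat_trace_def)
  also have "\<dots> = (\<Sum>c<d. \<Sum>r<n. mat_adjoint A $$ (c, r) * B $$ (r, c))"
    using assms by (intro sum.cong index_mult_mat_sum) auto
  also have "\<dots> = (\<Sum>c<d. \<Sum>r<n. cnj (A $$ (r, c)) * B $$ (r, c))"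
    using assms by (intro sum.cong) auto
  also have "\<dots> = (\<Sum>r<n. \<Sum>c<d. cnj (A $$ (r, c)) * B $$ (r, c))"
    by (rule sum.swap)
  finally show ?thesis .
qed

text \<open>Induction on the list of blocks: past the first block, subtracting \<open>m\<close> from
  an index lowers its quotient by one and keeps its remainder modulo \<open>m\<close>.\<close>

lemma diag_block_mat_uniform:
  assumes "\<And>A. A \<in> set As \<Longrightarrow> A \<in> carrier_mat m m"
  shows "diag_block_mat As \<in> carrier_mat (length As * m) (length As * m)"
    and "r < length As * m \<Longrightarrow> c < length As * m \<Longrightarrow> diag_block_mat As $$ (r, c) =
      (if r div m = c div m then As ! (r div m) $$ (r mod m, c mod m) else 0)"
proof -
  have "diag_block_mat As \<in> carrier_mat (length As * m) (length As * m) \<and>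
    (\<forall>r c. r < length As * m \<longrightarrow> c < length As * m \<longrightarrow> diag_block_mat As $$ (r, c) =
      (if r div m = c div m then As ! (r div m) $$ (r mod m, c mod m) else 0))"
    using assms
  proof (induction As)
    case Nil
    show ?case by simp
  next
    case (Cons A As)
    have A: "A \<in> carrier_mat m m" using Cons.prems by simp
    have IH: "diag_block_mat As \<in> carrier_mat (length As * m) (length As * m)"
      "\<And>r c. r < length As * m \<Longrightarrow> c < length As * m \<Longrightarrow> diag_block_mat As $$ (r, c) =
      (if r div m = c div m then As ! (r div m) $$ (r mod m, c mod m) else 0)"
      using Cons by auto
    have "diag_block_mat (A # As) $$ (r, c) =
      (if r div m = c div m then (A # As) ! (r div m) $$ (r mod m, c mod m) else 0)"
      if r: "r < length (A # As) * m" and c: "c < length (A # As) * m" for r c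
    proof -
      have m: "0 < m" using r by (cases m) auto
      have shift: "a div m = Suc ((a - m) div m)" "a mod m = (a - m) mod m"
        if "\<not> a < m" for a
        using that m by (auto simp: le_div_geq le_mod_geq)
      have "r - m < length As * m \<or> r < m" "c - m < length As * m \<or> c < m"
        using r c by auto
      then show ?thesis
        using A IH(1) r c by (auto simp: Let_def IH(2) shift[of r] shift[of c])
    qed
    then show ?case using A IH(1) by (auto simp: Let_def)
  qed
  then show "diag_block_mat As \<in> carrier_mat (length As * m) (length As * m)"
    and "r < length As * m \<Longrightarrow> c < length As * m \<Longrightarrow> diag_block_mat As $$ (r, c) =
      (if r div m = c div m then As ! (r div m) $$ (r mod m, c mod m) else 0)" by blast+
qed

text \<open>Sums of matrices live in the abelian group of matrices of a fixed size, because the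
  empty sum must know its dimensions. Taking an entry is additive, so induction on the index set
  reduces such a sum to complex numbers.\<close>

lemma finsum_module_mat:
  fixes f :: "'b \<Rightarrow> complex mat"
  assumes "finite F" "\<And>l. l \<in> F \<Longrightarrow> f l \<in> carrier_mat n m"
  shows "finsum (module_mat TYPE(complex) n m) f F \<in> carrier_mat n m"
    and "r < n \<Longrightarrow> c < m \<Longrightarrow>
      finsum (module_mat TYPE(complex) n m) f F $$ (r, c) = (\<Sum>l\<in>F. f l $$ (r, c))"
proof -
  interpret abelian_group "module_mat TYPE(complex) n m"
    by (rule abelian_group_mat)
  have car: "f \<in> F \<rightarrow> carrier (module_mat TYPE(complex) n m)"
    using assms(2) by (auto simp: module_mat_simps)
  show "finsum (module_mat TYPE(complex) n m) f F \<in> carrier_mat n m"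
    using finsum_closed[OF car] by (simp add: module_mat_simps)
  show "finsum (module_mat TYPE(complex) n m) f F $$ (r, c) = (\<Sum>l\<in>F. f l $$ (r, c))"
    if "r < n" "c < m"
    using assms
  proof (induction F)
    case empty
    show ?case using that by (simp add: module_mat_simps)
  next
    case (insert l F)
    have car: "f \<in> F \<rightarrow> carrier (module_mat TYPE(complex) n m)"
      "f l \<in> carrier (module_mat TYPE(complex) n m)"
      using insert.prems by (auto simp: module_mat_simps)
    have "finsum (module_mat TYPE(complex) n m) f F \<in> carrier_mat n m"
      using finsum_closed[OF car(1)] by (simp add: module_mat_simps)
    then show ?case
      using insert that by (simp add: finsum_insert[OF insert.hyps car] module_mat_simps)
  qed
qed

section \<open>The matrices \<open>WQW\<close> and \<open>Gamma_mat\<close> act row by row\<close>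

lemma serving_station:
  assumes "valid_system s" "i < n_users s" "r < n_rows s i"
  shows "r div n_antennas s < length (serving s i)"
    and "serving s i ! (r div n_antennas s) \<in> set (serving s i)"
    and "serving s i ! (r div n_antennas s) < n_stations s"
proof -
  show *: "r div n_antennas s < length (serving s i)"
    using assms(3) by (simp add: n_rows_def less_mult_imp_div_less)
  then show "serving s i ! (r div n_antennas s) \<in> set (serving s i)" by simp
  with assms show "serving s i ! (r div n_antennas s) < n_stations s"
    by (auto simp: valid_system_def)
qed

lemma block_index_less:
  fixes k n M p :: nat
  assumes "k < n" "p < M"
  shows "k * M + p < n * M"
proof -
  have "k * M + p < Suc k * M" using assms(2) by simp
  also have "\<dots> \<le> n * M" using assms(1) by (intro mult_le_mono1) simp
  finally show ?thesis .
qed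

lemma WQW_carrier: "WQW s i k \<in> carrier_mat (n_rows s i) (n_rows s i)"
  by (rule carrier_matI) (simp_all add: WQW_def W_mat_def)

text \<open>\<open>W_mat\<close> is the 0/1 matrix of the embedding \<open>emb\<close>, which moves
  a row of user \<open>i\<close> to the same offset in the block of its station. Hence entry (r, c)
  of the product tests whether \<open>emb r = emb c\<close> and whether that row lies in block
  \<open>k\<close>. The stations of a user are distinct, so \<open>emb\<close> is injective and the
  product is diagonal.\<close>

lemma index_WQW:
  assumes v: "valid_system s" and i: "i < n_users s" and k: "k < n_stations s"
    and r: "r < n_rows s i" and c: "c < n_rows s i"
  shows "WQW s i k $$ (r, c) = (if r = c \<and> serving s i ! (r div n_antennas s) = k then 1 else 0)"
proof -
  define M where "M = n_antennas s"
  define N where "N = n_stations s * M"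
  define emb where "emb r = serving s i ! (r div M) * M + r mod M" for r
  have M: "0 < M" using v by (simp add: M_def valid_system_def)
  have W: "W_mat s i \<in> carrier_mat N (n_rows s i)"
    by (simp add: W_mat_def N_def M_def)
  \<comment> \<open>Quotient and remainder by \<open>M\<close> determine a row, so the block
    condition in \<open>W_mat\<close> singles out one row for each column.\<close>
  have emb_iff: "a div M = serving s i ! (b div M) \<and> a mod M = b mod M \<longleftrightarrow> a = emb b" for a b
    using M by (auto simp: emb_def) (metis div_mult_mod_eq)
  have iW: "W_mat s i $$ (a, b) = (if a = emb b then 1 else 0)" if "a < N" "b < n_rows s i" for a b
    using that M unfolding emb_iff[symmetric] by (auto simp: W_mat_def N_def M_def)
  have emb_less: "emb b < N" if "b < n_rows s i" for b
    using serving_station(3)[OF v i that] M by (simp add: emb_def N_def M_def block_index_less)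
  have emb_div: "emb b div M = serving s i ! (b div M)" for b
    using M by (simp add: emb_def)
  have emb_inj: "emb r = emb c \<longleftrightarrow> r = c"
  proof
    assume eq: "emb r = emb c"
    then have "r mod M = c mod M" "serving s i ! (r div M) = serving s i ! (c div M)"
      using emb_iff by metis+
    moreover have "distinct (serving s i)" using v i by (simp add: valid_system_def)
    ultimately have "r div M = c div M"
      using serving_station(1)[OF v i] r c by (simp add: nth_eq_iff_index_eq M_def)
    with \<open>r mod M = c mod M\<close> show "r = c" by (metis div_mult_mod_eq)
  qed simp
  let ?Qs = "map (\<lambda>j. if j = k then 1\<^sub>m (n_antennas s) else 0\<^sub>m (n_antennas s) (n_antennas s))
        [0..<n_stations s] :: complex mat list"
  have Qs: "A \<in> carrier_mat M M" if "A \<in> set ?Qs" for A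
    using that by (auto simp: M_def split: if_splits)
  have Q: "Q_mat s k \<in> carrier_mat N N"
    using diag_block_mat_uniform(1)[OF Qs, of ?Qs] by (simp add: Q_mat_def N_def)
  have iQ: "Q_mat s k $$ (a, b) = (if a = b \<and> a div M = k then 1 else 0)"
    if "a < N" "b < N" for a b
  proof -
    have "a div M < n_stations s" using that(1) by (simp add: N_def less_mult_imp_div_less)
    moreover have "a = b \<longleftrightarrow> a div M = b div M \<and> a mod M = b mod M"
      by (metis div_mult_mod_eq)
    ultimately show ?thesis
      using diag_block_mat_uniform(2)[OF Qs, of ?Qs a b] that M
      by (auto simp: Q_mat_def N_def M_def)
  qed
  have AQ: "(mat_adjoint (W_mat s i) * Q_mat s k) $$ (r, b) =
      (if b = emb r \<and> b div M = k then 1 else 0)" if b: "b < N" for b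
  proof -
    have "(mat_adjoint (W_mat s i) * Q_mat s k) $$ (r, b) =
        (\<Sum>a<N. mat_adjoint (W_mat s i) $$ (r, a) * Q_mat s k $$ (a, b))"
      using W Q r b by (intro index_mult_mat_sum) auto
    \<comment> \<open>Row \<open>r\<close> of the adjoint has its only 1 at column
      \<open>emb r\<close>. The inner value is written with \<open>emb r\<close> in place of
      \<open>a\<close>, so that the sum collapses to one term.\<close>
    also have "\<dots> = (\<Sum>a<N. if a = emb r then if emb r = b \<and> b div M = k then 1 else 0 else 0)"
      using W r b by (intro sum.cong) (auto simp: iW iQ)
    also have "\<dots> = (if b = emb r \<and> b div M = k then 1 else 0)"
      using emb_less[OF r] by auto
    finally show ?thesis .
  qed
  have "WQW s i k $$ (r, c) =
      (\<Sum>b<N. (mat_adjoint (W_mat s i) * Q_mat s k) $$ (r, b) * W_mat s i $$ (b, c))"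
    unfolding WQW_def using W Q r c by (intro index_mult_mat_sum) auto
  also have "\<dots> = (\<Sum>b<N. if b = emb c then if emb r = emb c \<and> emb c div M = k then 1 else 0 else 0)"
    using c by (intro sum.cong) (auto simp: iW AQ)
  also have "\<dots> = (if emb r = emb c \<and> emb c div M = k then 1 else 0)"
    using emb_less[OF c] by auto
  finally show ?thesis using emb_inj emb_div[of c] by (auto simp: M_def)
qed

lemma index_WQW_mult:
  assumes "valid_system s" "i < n_users s" "k < n_stations s" "X \<in> carrier_mat (n_rows s i) d"
    "r < n_rows s i" "c < d"
  shows "(WQW s i k * X) $$ (r, c) =
    (if serving s i ! (r div n_antennas s) = k then X $$ (r, c) else 0)"
proof -
  have "(WQW s i k * X) $$ (r, c) = (\<Sum>a<n_rows s i. WQW s i k $$ (r, a) * X $$ (a, c))"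
    using assms WQW_carrier[of s i k] by (intro index_mult_mat_sum) auto
  also have "\<dots> = (\<Sum>a<n_rows s i. if a = r then
      if serving s i ! (r div n_antennas s) = k then X $$ (r, c) else 0 else 0)"
    using assms by (intro sum.cong) (auto simp: index_WQW)
  finally show ?thesis using assms(5) by auto
qed

lemma mat_trace_WQW:
  assumes "valid_system s" "i < n_users s" "k < n_stations s"
    and X: "X \<in> carrier_mat (n_rows s i) d" and Y: "Y \<in> carrier_mat (n_rows s i) d"
  shows "mat_trace (mat_adjoint X * WQW s i k * Y) = (\<Sum>r<n_rows s i. \<Sum>c<d.
    if serving s i ! (r div n_antennas s) = k then cnj (X $$ (r, c)) * Y $$ (r, c) else 0)"
proof -
  let ?Z = "WQW s i k * Y"
  have Z: "?Z \<in> carrier_mat (n_rows s i) d" using WQW_carrier Y by (rule mult_carrier_mat)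
  have "mat_trace (mat_adjoint X * WQW s i k * Y) = mat_trace (mat_adjoint X * ?Z)"
    using X Y by (subst assoc_mult_mat[OF mat_adjoint_carrier[OF X] WQW_carrier Y]) simp
  also have "\<dots> = (\<Sum>r<n_rows s i. \<Sum>c<d. cnj (X $$ (r, c)) * ?Z $$ (r, c))"
    using X Z by (rule mat_trace_adjoint_mult)
  also have "\<dots> = (\<Sum>r<n_rows s i. \<Sum>c<d.
      if serving s i ! (r div n_antennas s) = k then cnj (X $$ (r, c)) * Y $$ (r, c) else 0)"
    by (intro sum.cong) (auto simp: index_WQW_mult[OF assms(1-3) Y] simp del: index_mult_mat(1))
  finally show ?thesis .
qed

lemma Gamma_mat_carrier: "Gamma_mat s P \<xi> i \<in> carrier_mat (n_rows s i) (n_rows s i)"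
proof -
  let ?Gs = "map (\<lambda>k. complex_of_real (gamma_coeff s P \<xi> k) \<cdot>\<^sub>m 1\<^sub>m (n_antennas s)) (serving s i)"
  have "diag_block_mat ?Gs \<in> carrier_mat (length ?Gs * n_antennas s) (length ?Gs * n_antennas s)"
    by (rule diag_block_mat_uniform(1)) auto
  then show ?thesis by (simp only: Gamma_mat_def n_rows_def length_map)
qed

lemma index_Gamma_mat_mult:
  assumes v: "valid_system s" and i: "i < n_users s" and X: "X \<in> carrier_mat (n_rows s i) d"
    and r: "r < n_rows s i" and c: "c < d"
  shows "(Gamma_mat s P \<xi> i * X) $$ (r, c) =
    complex_of_real (gamma_coeff s P \<xi> (serving s i ! (r div n_antennas s))) * X $$ (r, c)"
proof -
  let ?M = "n_antennas s"
  let ?Gs = "map (\<lambda>k. complex_of_real (gamma_coeff s P \<xi> k) \<cdot>\<^sub>m 1\<^sub>m (n_antennas s)) (serving s i)"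
  have M: "0 < ?M" using v by (simp add: valid_system_def)
  have G: "Gamma_mat s P \<xi> i $$ (r, a) = (if a = r then
      complex_of_real (gamma_coeff s P \<xi> (serving s i ! (r div n_antennas s))) else 0)"
    if a: "a < n_rows s i" for a
  proof -
    have "Gamma_mat s P \<xi> i $$ (r, a) =
        (if r div ?M = a div ?M then ?Gs ! (r div ?M) $$ (r mod ?M, a mod ?M) else 0)"
      unfolding Gamma_mat_def using a r
      by (intro diag_block_mat_uniform(2)) (auto simp: n_rows_def)
    moreover have "a = r \<longleftrightarrow> r div ?M = a div ?M \<and> r mod ?M = a mod ?M"
      by (metis div_mult_mod_eq)
    ultimately show ?thesis
      using M serving_station(1)[OF v i r] by auto
  qed
  have "(Gamma_mat s P \<xi> i * X) $$ (r, c) =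
      (\<Sum>a<n_rows s i. Gamma_mat s P \<xi> i $$ (r, a) * X $$ (a, c))"
    using Gamma_mat_carrier[of s P \<xi> i] X r c by (intro index_mult_mat_sum) auto
  also have "\<dots> = (\<Sum>a<n_rows s i. if a = r then
      complex_of_real (gamma_coeff s P \<xi> (serving s i ! (r div n_antennas s))) * X $$ (r, c) else 0)"
    by (intro sum.cong) (auto simp: G)
  finally show ?thesis using r by auto
qed

section \<open>Real coordinates\<close>

definition station :: "mimo_system \<Rightarrow> coord_idx \<Rightarrow> nat" where
  "station s = (\<lambda>(i, r, c, b). serving s i ! (r div n_antennas s))"

text \<open>The metric restricted to the coordinates owned by station \<open>k\<close>. Its
  arguments are coordinate vectors, not tuples of matrices, so that the same expression serves on
  the manifold and on the open coordinate domains used for smoothness.\<close>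

definition station_dot ::
  "mimo_system \<Rightarrow> nat \<Rightarrow> (coord_idx \<Rightarrow> real) \<Rightarrow> (coord_idx \<Rightarrow> real) \<Rightarrow> real" where
  "station_dot s k x y = (\<Sum>j\<in>{j \<in> idx1 s. station s j = k}. x j * y j)"

text \<open>The complex form behind the constraints and the tangency equations. These are complex
  equations, and Hermitian symmetry of this form is what shows that they amount to real
  ones.\<close>

definition station_form :: "mimo_system \<Rightarrow> nat \<Rightarrow> complex mat list \<Rightarrow> complex mat list \<Rightarrow> complex" where
  "station_form s k X Y = (\<Sum>i\<in>users_of s k. mat_trace (mat_adjoint (X ! i) * WQW s i k * Y ! i))"

lemma idx1_Sigma:
  "idx1 s = (SIGMA i:{..<n_users s}. SIGMA r:{..<n_rows s i}. {..<n_streams s i} \<times> UNIV)"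
  by (auto simp: idx1_def)

lemma finite_idx1 [simp]: "finite (idx1 s)"
  unfolding idx1_Sigma by (intro finite_SigmaI) auto

lemma sum_idx1:
  "(\<Sum>j\<in>idx1 s. h j) = (\<Sum>i<n_users s. \<Sum>r<n_rows s i. \<Sum>c<n_streams s i.
     h (i, r, c, False) + h (i, r, c, True))"
  for h :: "coord_idx \<Rightarrow> 'a :: comm_monoid_add"
proof -
  have "(\<Sum>i<n_users s. \<Sum>r<n_rows s i. \<Sum>c<n_streams s i. \<Sum>b\<in>UNIV. h (i, r, c, b)) =
      (\<Sum>j\<in>idx1 s. case j of (i, r, c, b) \<Rightarrow> h (i, r, c, b))"
    unfolding idx1_Sigma by (simp add: sum.Sigma split_def)
  then show ?thesis by (simp add: UNIV_bool add.commute)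
qed

lemma station_less: "valid_system s \<Longrightarrow> j \<in> idx1 s \<Longrightarrow> station s j < n_stations s"
  by (auto simp: idx1_def station_def intro: serving_station(3))

lemma sum_by_station:
  fixes h :: "coord_idx \<Rightarrow> 'a :: comm_monoid_add"
  assumes "valid_system s"
  shows "(\<Sum>j\<in>idx1 s. h j) = (\<Sum>k<n_stations s. \<Sum>j\<in>{j \<in> idx1 s. station s j = k}. h j)"
  using station_less[OF assms] by (intro sum.group[symmetric]) auto

lemma coord1_simps:
  "i < n_users s \<Longrightarrow> r < n_rows s i \<Longrightarrow> c < n_streams s i \<Longrightarrow>
    coord1 s X (i, r, c, b) = (if b then Im (X ! i $$ (r, c)) else Re (X ! i $$ (r, c)))"
  by (auto simp: coord1_def idx1_def)

lemma ambientD: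
  assumes "X \<in> ambient s"
  shows "length X = n_users s" "i < n_users s \<Longrightarrow> X ! i \<in> carrier_mat (n_rows s i) (n_streams s i)"
  using assms by (auto simp: ambient_def)

lemma ambient_dims:
  assumes "X \<in> ambient s" "i < n_users s"
  shows "dim_row (X ! i) = n_rows s i" "dim_col (X ! i) = n_streams s i"
  using ambientD(2)[OF assms] by auto

text \<open>Reduces equations between tuples to coordinates: membership in \<open>ambient\<close>
  fixes all dimensions, and real and imaginary parts determine the entries.\<close>

lemma ambient_eqI:
  assumes X: "X \<in> ambient s" and Y: "Y \<in> ambient s"
    and eq: "\<And>j. j \<in> idx1 s \<Longrightarrow> coord1 s X j = coord1 s Y j"
  shows "X = Y"
proof (rule nth_equalityI)
  show "length X = length Y" using X Y by (simp add: ambientD)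
  fix i assume "i < length X"
  then have i: "i < n_users s" using X by (simp add: ambientD)
  note car = ambientD(2)[OF X i] ambientD(2)[OF Y i]
  show "X ! i = Y ! i"
  proof (rule eq_matI)
    fix r c assume "r < dim_row (Y ! i)" "c < dim_col (Y ! i)"
    then have rc: "r < n_rows s i" "c < n_streams s i" using car by auto
    have "(i, r, c, b) \<in> idx1 s" for b using i rc by (simp add: idx1_def)
    from eq[OF this[of False]] eq[OF this[of True]]
    show "X ! i $$ (r, c) = Y ! i $$ (r, c)"
      using i rc by (simp add: coord1_simps complex_eq_iff)
  qed (use car in auto)
qed

lemma station_dot_idx1:
  "station_dot s k x y = (\<Sum>j\<in>idx1 s. if station s j = k then x j * y j else 0)"
  unfolding station_dot_def by (rule sum.inter_filter) simp

lemma station_dot_commute: "station_dot s k x y = station_dot s k y x"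
  by (simp add: station_dot_def mult.commute)

lemma station_dot_nonneg: "0 \<le> station_dot s k x x"
  unfolding station_dot_def by (intro sum_nonneg) auto

lemma station_dot_add:
  "station_dot s k (\<lambda>j. x j + y j) z = station_dot s k x z + station_dot s k y z"
  "station_dot s k z (\<lambda>j. x j + y j) = station_dot s k z x + station_dot s k z y"
  by (simp_all add: station_dot_def algebra_simps sum.distrib)

lemma station_dot_diff:
  "station_dot s k (\<lambda>j. x j - y j) z = station_dot s k x z - station_dot s k y z"
  by (simp add: station_dot_def algebra_simps sum_subtractf)

text \<open>A factor that depends on \<open>j\<close> only through its station is constant on the
  group of \<open>k\<close> and leaves the sum. The factors \<open>gamma_coeff\<close> and
  \<open>rho_coeff\<close> are of this kind; a constant \<open>g\<close> gives ordinary
  homogeneity.\<close>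

lemma station_dot_scale:
  "station_dot s k (\<lambda>j. g (station s j) * x j) z = g k * station_dot s k x z"
  "station_dot s k z (\<lambda>j. g (station s j) * x j) = g k * station_dot s k z x"
  by (auto simp: station_dot_def sum_distrib_left intro!: sum.cong)

lemma station_dot_cong:
  assumes "\<And>j. j \<in> idx1 s \<Longrightarrow> x j = x' j" "\<And>j. j \<in> idx1 s \<Longrightarrow> y j = y' j"
  shows "station_dot s k x y = station_dot s k x' y'"
  unfolding station_dot_def using assms by (intro sum.cong) auto

lemma station_form_sum:
  assumes v: "valid_system s" and k: "k < n_stations s"
    and X: "X \<in> ambient s" and Y: "Y \<in> ambient s"
  shows "station_form s k X Y = (\<Sum>i<n_users s. \<Sum>r<n_rows s i. \<Sum>c<n_streams s i.
    if serving s i ! (r div n_antennas s) = k then cnj (X ! i $$ (r, c)) * Y ! i $$ (r, c) else 0)"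
proof -
  let ?f = "\<lambda>i. \<Sum>r<n_rows s i. \<Sum>c<n_streams s i.
    if serving s i ! (r div n_antennas s) = k then cnj (X ! i $$ (r, c)) * Y ! i $$ (r, c) else 0"
  have "station_form s k X Y = (\<Sum>i\<in>users_of s k. ?f i)"
    unfolding station_form_def using v k ambientD(2)[OF X] ambientD(2)[OF Y]
    by (intro sum.cong mat_trace_WQW) (auto simp: users_of_def)
  \<comment> \<open>A user outside \<open>users_of s k\<close> has no row of station
    \<open>k\<close>, so its terms vanish and the sum may run over all users, as the sum over
    \<open>idx1\<close> does.\<close>
  also have "\<dots> = (\<Sum>i<n_users s. ?f i)"
  proof (rule sum.mono_neutral_left)
    show "\<forall>i\<in>{..<n_users s} - users_of s k. ?f i = 0"
    proof (intro ballI sum.neutral)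
      fix i r c assume "i \<in> {..<n_users s} - users_of s k" "r \<in> {..<n_rows s i}"
      then have "serving s i ! (r div n_antennas s) \<noteq> k"
        using serving_station(2)[OF v, of i r] by (auto simp: users_of_def)
      then show "(if serving s i ! (r div n_antennas s) = k
          then cnj (X ! i $$ (r, c)) * Y ! i $$ (r, c) else 0) = 0" by simp
    qed
  qed (auto simp: users_of_def)
  finally show ?thesis .
qed

text \<open>The real part of cnj z * w is Re z * Re w + Im z * Im w, the contribution of the two
  real coordinates of one entry.\<close>

lemma Re_station_form:
  assumes "valid_system s" "k < n_stations s" "X \<in> ambient s" "Y \<in> ambient s"
  shows "Re (station_form s k X Y) = station_dot s k (coord1 s X) (coord1 s Y)"
  unfolding station_form_sum[OF assms] station_dot_idx1 sum_idx1 Re_sum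
  by (intro sum.cong) (auto simp: coord1_simps station_def)

lemma cnj_station_form:
  assumes "valid_system s" "k < n_stations s" "X \<in> ambient s" "Y \<in> ambient s"
  shows "cnj (station_form s k X Y) = station_form s k Y X"
  unfolding station_form_sum[OF assms] station_form_sum[OF assms(1,2,4,3)] cnj_sum
  by (intro sum.cong) (auto simp: mult.commute)

lemma station_form_self:
  assumes "valid_system s" "k < n_stations s" "X \<in> ambient s"
  shows "station_form s k X X = complex_of_real (station_dot s k (coord1 s X) (coord1 s X))"
  using Re_station_form[OF assms assms(3)] cnj_station_form[OF assms assms(3)]
  by (auto simp: complex_eq_iff)

text \<open>The two forms are complex conjugates, so their sum is twice a real part. This turns the
  complex tangency equation into one real orthogonality relation per station.\<close>

lemma station_form_symmetrised:
  assumes "valid_system s" "k < n_stations s" "X \<in> ambient s" "Y \<in> ambient s"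
  shows "station_form s k X Y + station_form s k Y X =
    complex_of_real (2 * station_dot s k (coord1 s X) (coord1 s Y))"
  using Re_station_form[OF assms] unfolding cnj_station_form[OF assms, symmetric]
  by (auto simp: complex_eq_iff)

section \<open>Constraints, tangency and metric in coordinates\<close>

lemma mat_trace_add:
  "A \<in> carrier_mat n n \<Longrightarrow> B \<in> carrier_mat n n \<Longrightarrow> mat_trace (A + B) = mat_trace A + mat_trace B"
  by (auto simp: mat_trace_def sum.distrib)

lemma manifold_iff:
  assumes "valid_system s"
  shows "P \<in> manifold_M s \<longleftrightarrow> P \<in> ambient s \<and>
    (\<forall>k<n_stations s. station_dot s k (coord1 s P) (coord1 s P) = tx_power s k)"
proof (cases "P \<in> ambient s")
  case True
  have "(\<Sum>i\<in>users_of s k. mat_trace (mat_adjoint (P ! i) * WQW s i k * P ! i)) =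
      complex_of_real (station_dot s k (coord1 s P) (coord1 s P))" if "k < n_stations s" for k
    using station_form_self[OF assms that True] by (simp add: station_form_def)
  then show ?thesis using True by (auto simp: manifold_M_def)
qed (simp add: manifold_M_def)

lemma tangent_iff:
  assumes v: "valid_system s" and P: "P \<in> ambient s"
  shows "\<xi> \<in> tangent s P \<longleftrightarrow> \<xi> \<in> ambient s \<and>
    (\<forall>k<n_stations s. station_dot s k (coord1 s \<xi>) (coord1 s P) = 0)"
proof (cases "\<xi> \<in> ambient s")
  case True
  have "(\<Sum>i\<in>users_of s k. mat_trace (mat_adjoint (\<xi> ! i) * WQW s i k * P ! i
                                  + mat_adjoint (P ! i) * WQW s i k * \<xi> ! i)) =
      complex_of_real (2 * station_dot s k (coord1 s \<xi>) (coord1 s P))" if k: "k < n_stations s" for k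
  proof -
    \<comment> \<open>Both products are square of the same size, which lets the trace split over
      their sum; the two halves form the symmetrised expression.\<close>
    have car: "mat_adjoint (X ! i) * WQW s i k * Y ! i \<in> carrier_mat (n_streams s i) (n_streams s i)"
      if "X \<in> ambient s" "Y \<in> ambient s" "i \<in> users_of s k" for X Y i
      using that by (intro mult_carrier_mat[OF mult_carrier_mat[OF mat_adjoint_carrier WQW_carrier]])
        (auto simp: users_of_def ambientD)
    show ?thesis
      unfolding station_form_symmetrised[OF v k True P, symmetric] station_form_def sum.distrib[symmetric]
      using True P by (intro sum.cong mat_trace_add) (auto intro: car)
  qed
  then show ?thesis using True by (auto simp: tangent_def)
qed (simp add: tangent_def)

lemma riem_metric_coord1:
  assumes X: "X \<in> ambient s" and Y: "Y \<in> ambient s"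
  shows "riem_metric s X Y = (\<Sum>j\<in>idx1 s. coord1 s X j * coord1 s Y j)"
proof -
  have "Re (mat_trace (mat_adjoint (Y ! i) * X ! i)) = (\<Sum>r<n_rows s i. \<Sum>c<n_streams s i.
      coord1 s X (i, r, c, False) * coord1 s Y (i, r, c, False) +
      coord1 s X (i, r, c, True) * coord1 s Y (i, r, c, True))" if i: "i < n_users s" for i
  proof -
    have "mat_trace (mat_adjoint (Y ! i) * X ! i) =
        (\<Sum>r<n_rows s i. \<Sum>c<n_streams s i. cnj (Y ! i $$ (r, c)) * X ! i $$ (r, c))"
      by (rule mat_trace_adjoint_mult[OF ambientD(2)[OF Y i] ambientD(2)[OF X i]])
    then show ?thesis
      using i by (auto simp: coord1_simps algebra_simps intro!: sum.cong)
  qed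
  then show ?thesis unfolding riem_metric_def sum_idx1 by (intro sum.cong) auto
qed

section \<open>Operations on tuples and the retraction in coordinates\<close>

lemma
  assumes "X \<in> ambient s" "Y \<in> ambient s"
  shows tup_add_ambient: "tup_add X Y \<in> ambient s"
    and coord1_tup_add: "j \<in> idx1 s \<Longrightarrow> coord1 s (tup_add X Y) j = coord1 s X j + coord1 s Y j"
    and tup_diff_ambient: "tup_diff X Y \<in> ambient s"
    and coord1_tup_diff: "j \<in> idx1 s \<Longrightarrow> coord1 s (tup_diff X Y) j = coord1 s X j - coord1 s Y j"
    and tup_add_nth: "i < n_users s \<Longrightarrow> tup_add X Y ! i = X ! i + Y ! i"
proof -
  note len = ambientD(1)[OF assms(1)] ambientD(1)[OF assms(2)]
  note car = ambientD(2)[OF assms(1)] ambientD(2)[OF assms(2)]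
  show nth: "tup_add X Y ! i = X ! i + Y ! i" if "i < n_users s" for i
    using that len by (simp add: tup_add_def)
  have nth': "tup_diff X Y ! i = X ! i - Y ! i" if "i < n_users s" for i
    using that len by (simp add: tup_diff_def)
  show "tup_add X Y \<in> ambient s" using car nth len by (auto simp: ambient_def) (simp add: tup_add_def)
  show "tup_diff X Y \<in> ambient s" using car nth' len
    by (auto simp: ambient_def minus_carrier_mat) (simp add: tup_diff_def)
  show "coord1 s (tup_add X Y) j = coord1 s X j + coord1 s Y j" if "j \<in> idx1 s"
    using that by (auto simp: idx1_def coord1_simps nth ambient_dims[OF assms(1)] ambient_dims[OF assms(2)])
  show "coord1 s (tup_diff X Y) j = coord1 s X j - coord1 s Y j" if "j \<in> idx1 s"
    using that by (auto simp: idx1_def coord1_simps nth' ambient_dims[OF assms(1)] ambient_dims[OF assms(2)])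
qed

lemma
  assumes "X \<in> ambient s"
  shows tup_scale_ambient: "tup_scale a X \<in> ambient s"
    and coord1_tup_scale: "j \<in> idx1 s \<Longrightarrow> coord1 s (tup_scale a X) j = a * coord1 s X j"
proof -
  note X = ambientD[OF assms]
  have nth: "tup_scale a X ! i = complex_of_real a \<cdot>\<^sub>m X ! i" if "i < n_users s" for i
    using that X(1) by (simp add: tup_scale_def)
  show "tup_scale a X \<in> ambient s" using X nth by (auto simp: ambient_def) (simp add: tup_scale_def)
  show "coord1 s (tup_scale a X) j = a * coord1 s X j" if "j \<in> idx1 s"
    using that by (auto simp: idx1_def coord1_simps nth ambient_dims[OF assms])
qed

lemma tup_zero_ambient: "tup_zero s \<in> ambient s"
  by (simp add: ambient_def tup_zero_def)

lemma coord1_tup_zero: "j \<in> idx1 s \<Longrightarrow> coord1 s (tup_zero s) j = 0"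
  by (auto simp: idx1_def coord1_simps tup_zero_def)

lemma gamma_coeff_station_dot:
  assumes v: "valid_system s" and k: "k < n_stations s" and P: "P \<in> ambient s" and \<xi>: "\<xi> \<in> ambient s"
  shows "gamma_coeff s P \<xi> k = sqrt (tx_power s k) / sqrt (station_dot s k
    (\<lambda>j. coord1 s P j + coord1 s \<xi> j) (\<lambda>j. coord1 s P j + coord1 s \<xi> j))"
proof -
  let ?X = "tup_add P \<xi>"
  have X: "?X \<in> ambient s" using P \<xi> by (rule tup_add_ambient)
  have "(\<Sum>i\<in>users_of s k. mat_trace (mat_adjoint (P ! i + \<xi> ! i) * WQW s i k * (P ! i + \<xi> ! i))) =
      station_form s k ?X ?X"
    unfolding station_form_def
    by (intro sum.cong) (auto simp: users_of_def tup_add_nth[OF P \<xi>])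
  also have "Re \<dots> = station_dot s k (coord1 s ?X) (coord1 s ?X)"
    by (rule Re_station_form[OF v k X X])
  also have "\<dots> = station_dot s k
    (\<lambda>j. coord1 s P j + coord1 s \<xi> j) (\<lambda>j. coord1 s P j + coord1 s \<xi> j)"
    by (intro station_dot_cong coord1_tup_add[OF P \<xi>])
  finally show ?thesis by (simp add: gamma_coeff_def)
qed

lemma rho_coeff_station_dot:
  assumes "valid_system s" "k < n_stations s" "X \<in> ambient s" "\<xi> \<in> ambient s"
  shows "rho_coeff s X \<xi> k = station_dot s k (coord1 s X) (coord1 s \<xi>) / tx_power s k"
  using Re_station_form[OF assms] by (simp add: rho_coeff_def station_form_def)

lemma
  assumes v: "valid_system s" and P: "P \<in> ambient s" and \<xi>: "\<xi> \<in> ambient s"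
  shows retr_M_ambient: "retr_M s P \<xi> \<in> ambient s"
    and retr_M_index: "i < n_users s \<Longrightarrow> r < n_rows s i \<Longrightarrow> c < n_streams s i \<Longrightarrow>
      retr_M s P \<xi> ! i $$ (r, c) =
        complex_of_real (gamma_coeff s P \<xi> (serving s i ! (r div n_antennas s))) *
          (P ! i $$ (r, c) + \<xi> ! i $$ (r, c))"
    and coord1_retr_M: "j \<in> idx1 s \<Longrightarrow> coord1 s (retr_M s P \<xi>) j =
      gamma_coeff s P \<xi> (station s j) * (coord1 s P j + coord1 s \<xi> j)"
proof -
  have car: "P ! i + \<xi> ! i \<in> carrier_mat (n_rows s i) (n_streams s i)" if "i < n_users s" for i
    using that P \<xi> by (simp add: ambientD)
  show "retr_M s P \<xi> \<in> ambient s"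
    using car mult_carrier_mat[OF Gamma_mat_carrier] by (auto simp: ambient_def retr_M_def)
  show idx: "retr_M s P \<xi> ! i $$ (r, c) =
        complex_of_real (gamma_coeff s P \<xi> (serving s i ! (r div n_antennas s))) *
          (P ! i $$ (r, c) + \<xi> ! i $$ (r, c))"
    if "i < n_users s" "r < n_rows s i" "c < n_streams s i" for i r c
    using that index_Gamma_mat_mult[OF v that(1) car[OF that(1)] that(2,3)]
      ambientD(2)[OF P that(1)] ambientD(2)[OF \<xi> that(1)]
    by (simp add: retr_M_def del: index_mult_mat(1))
  show "coord1 s (retr_M s P \<xi>) j =
      gamma_coeff s P \<xi> (station s j) * (coord1 s P j + coord1 s \<xi> j)" if "j \<in> idx1 s"
    using that by (auto simp: idx1_def coord1_simps idx station_def)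
qed

text \<open>Pythagoras in the group of station \<open>k\<close>: the mixed terms vanish by tangency,
  and the constraint gives the first summand. Hence the radicand of \<open>gamma_coeff\<close> is
  positive, and it depends on \<open>\<xi>\<close> only to second order, which later makes the
  scaling stationary at the zero vector.\<close>

lemma station_dot_step:
  assumes "valid_system s" "P \<in> manifold_M s" "\<xi> \<in> tangent s P" "k < n_stations s"
  shows "station_dot s k (\<lambda>j. coord1 s P j + coord1 s \<xi> j) (\<lambda>j. coord1 s P j + coord1 s \<xi> j) =
    tx_power s k + station_dot s k (coord1 s \<xi>) (coord1 s \<xi>)"
  using assms
  by (auto simp: manifold_iff tangent_iff station_dot_add station_dot_commute[of s k "coord1 s P" "coord1 s \<xi>"])

lemma tx_power_pos: "valid_system s \<Longrightarrow> k < n_stations s \<Longrightarrow> 0 < tx_power s k"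
  by (simp add: valid_system_def)

lemma retr_M_manifold:
  assumes v: "valid_system s" and P: "P \<in> manifold_M s" and \<xi>: "\<xi> \<in> tangent s P"
  shows "retr_M s P \<xi> \<in> manifold_M s"
proof -
  have amb: "P \<in> ambient s" "\<xi> \<in> ambient s"
    using P \<xi> by (auto simp: manifold_iff[OF v] tangent_def)
  have "station_dot s k (coord1 s (retr_M s P \<xi>)) (coord1 s (retr_M s P \<xi>)) = tx_power s k"
    if k: "k < n_stations s" for k
  proof -
    let ?q = "station_dot s k (\<lambda>j. coord1 s P j + coord1 s \<xi> j) (\<lambda>j. coord1 s P j + coord1 s \<xi> j)"
    have "0 < ?q"
      using station_dot_step[OF v P \<xi> k] tx_power_pos[OF v k] station_dot_nonneg[of s k "coord1 s \<xi>"]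
      by simp
    have "station_dot s k (coord1 s (retr_M s P \<xi>)) (coord1 s (retr_M s P \<xi>)) =
      station_dot s k (\<lambda>j. gamma_coeff s P \<xi> (station s j) * (coord1 s P j + coord1 s \<xi> j))
        (\<lambda>j. gamma_coeff s P \<xi> (station s j) * (coord1 s P j + coord1 s \<xi> j))"
      by (intro station_dot_cong coord1_retr_M[OF v amb])
    \<comment> \<open>Each slot contributes one factor \<open>gamma_coeff\<close>; the square of
      that factor is \<open>tx_power s k / ?q\<close>, so \<open>?q\<close> cancels
      afterwards.\<close>
    also have "\<dots> = gamma_coeff s P \<xi> k * (gamma_coeff s P \<xi> k * ?q)"
      by (simp only: station_dot_scale[where g = "gamma_coeff s P \<xi>"])
    also have "\<dots> = tx_power s k"
      using \<open>0 < ?q\<close> tx_power_pos[OF v k] by (simp add: gamma_coeff_station_dot[OF v k amb])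
    finally show ?thesis .
  qed
  then show ?thesis using retr_M_ambient[OF v amb] by (simp add: manifold_iff[OF v])
qed

section \<open>The orthogonal projection onto a tangent space\<close>

definition proj_formula :: "mimo_system \<Rightarrow> complex mat list \<Rightarrow> complex mat list \<Rightarrow> complex mat list" where
  "proj_formula s X \<xi> =
     map (\<lambda>i. \<xi> ! i - finsum (module_mat TYPE(complex) (n_rows s i) (n_streams s i))
            (\<lambda>l. complex_of_real (rho_coeff s X \<xi> l) \<cdot>\<^sub>m (WQW s i l * X ! i))
            (set (serving s i)))
       [0..<n_users s]"

lemma
  assumes v: "valid_system s" and X: "X \<in> ambient s" and \<xi>: "\<xi> \<in> ambient s"
  shows proj_formula_ambient: "proj_formula s X \<xi> \<in> ambient s"
    and coord1_proj_formula: "j \<in> idx1 s \<Longrightarrow> coord1 s (proj_formula s X \<xi>) j =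
      coord1 s \<xi> j - rho_coeff s X \<xi> (station s j) * coord1 s X j"
proof -
  let ?f = "\<lambda>i l. complex_of_real (rho_coeff s X \<xi> l) \<cdot>\<^sub>m (WQW s i l * X ! i)"
  let ?S = "\<lambda>i. finsum (module_mat TYPE(complex) (n_rows s i) (n_streams s i)) (?f i) (set (serving s i))"
  have car: "?f i l \<in> carrier_mat (n_rows s i) (n_streams s i)" if "i < n_users s" for i l
    using mult_carrier_mat[OF WQW_carrier ambientD(2)[OF X that]] by simp
  have S: "?S i \<in> carrier_mat (n_rows s i) (n_streams s i)" if "i < n_users s" for i
    by (rule finsum_module_mat(1)) (auto intro: car[OF that])
  show "proj_formula s X \<xi> \<in> ambient s"
    using S by (auto simp: ambient_def proj_formula_def minus_carrier_mat)
  have idx: "proj_formula s X \<xi> ! i $$ (r, c) = \<xi> ! i $$ (r, c) -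
      complex_of_real (rho_coeff s X \<xi> (serving s i ! (r div n_antennas s))) * X ! i $$ (r, c)"
    if i: "i < n_users s" and r: "r < n_rows s i" and c: "c < n_streams s i" for i r c
  proof -
    let ?k = "serving s i ! (r div n_antennas s)"
    have "?S i $$ (r, c) = (\<Sum>l\<in>set (serving s i). ?f i l $$ (r, c))"
      by (rule finsum_module_mat(2)) (auto intro: car[OF i] r c)
    \<comment> \<open>\<open>WQW s i l\<close> erases all rows not owned by \<open>l\<close>, so row
      \<open>r\<close> receives only the summand of its own station \<open>?k\<close>, which belongs
      to the serving list.\<close>
    also have "\<dots> = (\<Sum>l\<in>set (serving s i). if l = ?k then
        complex_of_real (rho_coeff s X \<xi> ?k) * X ! i $$ (r, c) else 0)"
    proof (rule sum.cong)
      fix l assume l: "l \<in> set (serving s i)"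
      then have "l < n_stations s" using v i by (auto simp: valid_system_def)
      from index_WQW_mult[OF v i this ambientD(2)[OF X i] r c]
      show "?f i l $$ (r, c) = (if l = ?k then
          complex_of_real (rho_coeff s X \<xi> ?k) * X ! i $$ (r, c) else 0)"
        using r c WQW_carrier[of s i l] ambientD(2)[OF X i]
        by (auto simp del: index_mult_mat(1))
    qed simp
    also have "\<dots> = complex_of_real (rho_coeff s X \<xi> ?k) * X ! i $$ (r, c)"
      using serving_station(2)[OF v i r] by simp
    finally show ?thesis
      using i r c S[OF i] by (simp add: proj_formula_def)
  qed
  show "coord1 s (proj_formula s X \<xi>) j =
      coord1 s \<xi> j - rho_coeff s X \<xi> (station s j) * coord1 s X j" if "j \<in> idx1 s"
    using that by (auto simp: idx1_def coord1_simps idx station_def)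
qed

text \<open>On the manifold the squared norm of the k-th group of \<open>X\<close> is
  \<open>tx_power s k\<close>, so \<open>rho_coeff\<close> is the Gram-Schmidt coefficient <X,
  \<xi>> / <X, X> of that group, and subtracting its multiple of \<open>X\<close> leaves a vector
  orthogonal to \<open>X\<close> there.\<close>

lemma proj_formula_tangent:
  assumes v: "valid_system s" and X: "X \<in> manifold_M s" and \<xi>: "\<xi> \<in> ambient s"
  shows "proj_formula s X \<xi> \<in> tangent s X"
proof -
  have amb: "X \<in> ambient s" using X by (simp add: manifold_iff[OF v])
  have "station_dot s k (coord1 s (proj_formula s X \<xi>)) (coord1 s X) = 0" if k: "k < n_stations s" for k
  proof -
    have "station_dot s k (coord1 s (proj_formula s X \<xi>)) (coord1 s X) =
      station_dot s k (\<lambda>j. coord1 s \<xi> j - rho_coeff s X \<xi> (station s j) * coord1 s X j) (coord1 s X)"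
      by (intro station_dot_cong coord1_proj_formula[OF v amb \<xi>] refl)
    also have "\<dots> = station_dot s k (coord1 s \<xi>) (coord1 s X) -
        rho_coeff s X \<xi> k * station_dot s k (coord1 s X) (coord1 s X)"
      by (simp only: station_dot_diff station_dot_scale[where g = "rho_coeff s X \<xi>"])
    also have "\<dots> = 0"
      using X k tx_power_pos[OF v k] station_dot_commute[of s k "coord1 s \<xi>" "coord1 s X"]
      by (simp add: manifold_iff[OF v] rho_coeff_station_dot[OF v k amb \<xi>])
    finally show ?thesis .
  qed
  then show ?thesis
    using proj_formula_ambient[OF v amb \<xi>] by (simp add: tangent_iff[OF v amb])
qed

text \<open>The residual is a combination of the station groups of \<open>X\<close>, each orthogonal
  to all tangent vectors; this gives existence. The description by \<open>THE\<close> also demands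
  uniqueness, which follows from definiteness of the metric.\<close>

lemma orth_proj_tangent:
  assumes v: "valid_system s" and X: "X \<in> manifold_M s" and \<xi>: "\<xi> \<in> ambient s"
  shows "orth_proj s (tangent s X) \<xi> = proj_formula s X \<xi>"
  unfolding orth_proj_def
proof (rule the_equality)
  let ?y = "proj_formula s X \<xi>"
  have amb: "X \<in> ambient s" using X by (simp add: manifold_iff[OF v])
  have metric: "riem_metric s (tup_diff \<xi> y) z =
      (\<Sum>j\<in>idx1 s. (coord1 s \<xi> j - coord1 s y j) * coord1 s z j)"
    if "y \<in> tangent s X" "z \<in> tangent s X" for y z
    using that \<xi> by (auto simp: riem_metric_coord1 tangent_def tup_diff_ambient coord1_tup_diff)
  have y: "?y \<in> tangent s X" using v X \<xi> by (rule proj_formula_tangent)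
  have orth: "riem_metric s (tup_diff \<xi> ?y) z = 0" if z: "z \<in> tangent s X" for z
  proof -
    have "riem_metric s (tup_diff \<xi> ?y) z =
        (\<Sum>j\<in>idx1 s. rho_coeff s X \<xi> (station s j) * coord1 s X j * coord1 s z j)"
      unfolding metric[OF y z] by (intro sum.cong) (auto simp: coord1_proj_formula[OF v amb \<xi>])
    \<comment> \<open>A tangent vector is orthogonal to every group of \<open>X\<close> separately,
      so the sum is split by station and the coefficient of each station is taken out.\<close>
    also have "\<dots> = (\<Sum>k<n_stations s. rho_coeff s X \<xi> k * station_dot s k (coord1 s X) (coord1 s z))"
      unfolding sum_by_station[OF v] station_dot_scale(1)[where g = "rho_coeff s X \<xi>", symmetric]
      by (simp add: station_dot_def)
    also have "\<dots> = 0"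
      using z by (intro sum.neutral) (auto simp: tangent_iff[OF v amb] station_dot_commute[of s _ "coord1 s X"])
    finally show ?thesis .
  qed
  show "?y \<in> tangent s X \<and> (\<forall>z\<in>tangent s X. riem_metric s (tup_diff \<xi> ?y) z = 0)"
    using y orth by blast
  fix y' assume y': "y' \<in> tangent s X \<and> (\<forall>z\<in>tangent s X. riem_metric s (tup_diff \<xi> y') z = 0)"
  let ?d = "\<lambda>j. coord1 s ?y j - coord1 s y' j"
  \<comment> \<open>Bilinear expansion of the squared distance between two candidates. All four
    terms vanish, because both residuals are orthogonal to both candidates, which are themselves
    tangent vectors.\<close>
  have "(\<Sum>j\<in>idx1 s. (?d j)\<^sup>2) =
      (riem_metric s (tup_diff \<xi> y') ?y - riem_metric s (tup_diff \<xi> y') y') -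
      (riem_metric s (tup_diff \<xi> ?y) ?y - riem_metric s (tup_diff \<xi> ?y) y')"
    using y y' by (simp add: metric sum_subtractf[symmetric] power2_eq_square algebra_simps)
  also have "\<dots> = 0" using y y' orth by simp
  finally have "\<forall>j\<in>idx1 s. (?d j)\<^sup>2 = 0" by (subst (asm) sum_nonneg_eq_0_iff) auto
  then show "y' = ?y"
    using y y' by (intro ambient_eqI[of _ s]) (auto simp: tangent_def)
qed

section \<open>Retraction and transport\<close>

lemma coord1_extensional: "coord1 s X \<in> extensional (idx1 s)"
  by (simp add: coord1_def)

text \<open>Points of the product topology are extensional functions, so joint coordinates must take
  the default value \<open>undefined\<close> off the index set in order to lie in the open
  domains.\<close>

lemma case_sum_extensional:
  assumes f: "f \<in> extensional A" and g: "g \<in> extensional B"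
  shows "case_sum f g \<in> extensional (A <+> B)"
  unfolding extensional_def
proof (intro CollectI allI impI)
  fix x assume x: "x \<notin> A <+> B"
  show "case_sum f g x = undefined"
  proof (cases x)
    case (Inl a)
    with x have "a \<notin> A" by blast
    with Inl show ?thesis by (simp add: extensional_arb[OF f])
  next
    case (Inr b)
    with x have "b \<notin> B" by blast
    with Inr show ?thesis by (simp add: extensional_arb[OF g])
  qed
qed

lemma coord2_in_topspace: "coord2 s p \<in> topspace (powertop_real (idx2 s))"
  by (cases p) (simp add: coord2_def idx2_def PiE_def case_sum_extensional coord1_extensional)

lemma coord3_in_topspace: "coord3 s p \<in> topspace (powertop_real (idx3 s))"
  using coord2_in_topspace[of s "snd p"]
  by (cases p) (simp add: coord3_def idx3_def PiE_def case_sum_extensional coord1_extensional)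

lemma station_dot_smooth_alg:
  assumes "\<And>j. j \<in> idx1 s \<Longrightarrow> (\<lambda>x. f x j) \<in> smooth_alg I D" "\<And>j. j \<in> idx1 s \<Longrightarrow> (\<lambda>x. g x j) \<in> smooth_alg I D"
  shows "(\<lambda>x. station_dot s k (f x) (g x)) \<in> smooth_alg I D"
  unfolding station_dot_def using assms by (intro smooth_alg_sum smooth_alg.mult) auto

definition step_power ::
  "mimo_system \<Rightarrow> nat \<Rightarrow> (coord_idx \<Rightarrow> real) \<Rightarrow> (coord_idx \<Rightarrow> real) \<Rightarrow> real" where
  "step_power s k x y = station_dot s k (\<lambda>j. x j + y j) (\<lambda>j. x j + y j)"

text \<open>Extends the coordinates of the retraction from the tangent bundle to arbitrary
  coordinate vectors. The reciprocal root appears as one factor, matching the generator of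
  \<open>smooth_alg\<close>.\<close>

definition retr_coord ::
  "mimo_system \<Rightarrow> (coord_idx \<Rightarrow> real) \<Rightarrow> (coord_idx \<Rightarrow> real) \<Rightarrow> coord_idx \<Rightarrow> real" where
  "retr_coord s x y j = sqrt (tx_power s (station s j)) *
     (1 / sqrt (step_power s (station s j) x y)) * (x j + y j)"

lemma step_power_smooth_alg:
  assumes "\<And>j. j \<in> idx1 s \<Longrightarrow> (\<lambda>x. f x j) \<in> smooth_alg I D" "\<And>j. j \<in> idx1 s \<Longrightarrow> (\<lambda>x. g x j) \<in> smooth_alg I D"
  shows "(\<lambda>x. step_power s k (f x) (g x)) \<in> smooth_alg I D"
  unfolding step_power_def using assms by (intro station_dot_smooth_alg smooth_alg.add)

lemma retr_coord_smooth_alg: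
  assumes "\<And>j. j \<in> idx1 s \<Longrightarrow> (\<lambda>x. f x j) \<in> smooth_alg I D" "\<And>j. j \<in> idx1 s \<Longrightarrow> (\<lambda>x. g x j) \<in> smooth_alg I D"
    and "\<And>x. x \<in> D \<Longrightarrow> 0 < step_power s (station s j) (f x) (g x)" and "j \<in> idx1 s"
  shows "(\<lambda>x. retr_coord s (f x) (g x) j) \<in> smooth_alg I D"
  unfolding retr_coord_def using assms
  by (intro smooth_alg.mult smooth_alg.const smooth_alg.rsqrt smooth_alg.add step_power_smooth_alg) auto

lemma retr_coord_coord1:
  assumes "valid_system s" "P \<in> ambient s" "\<xi> \<in> ambient s" "j \<in> idx1 s"
  shows "coord1 s (retr_M s P \<xi>) j = retr_coord s (coord1 s P) (coord1 s \<xi>) j"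
  using assms by (simp add: coord1_retr_M gamma_coeff_station_dot station_less retr_coord_def step_power_def)

lemma step_power_pos:
  assumes "valid_system s" "P \<in> manifold_M s" "\<xi> \<in> tangent s P" "k < n_stations s"
  shows "0 < step_power s k (coord1 s P) (coord1 s \<xi>)"
  using station_dot_step[OF assms] tx_power_pos[OF assms(1,4)] station_dot_nonneg[of s k "coord1 s \<xi>"]
  by (simp add: step_power_def)

lemma bundle_ambient:
  assumes "P \<in> manifold_M s" "\<xi> \<in> tangent s P"
  shows "P \<in> ambient s" "\<xi> \<in> ambient s"
  using assms by (auto simp: manifold_M_def tangent_def)

text \<open>One domain and one extension serve at all points: the set where every step power is
  positive. It is open because step powers are polynomial, and it contains the tangent bundle by
  Pythagoras.\<close>

lemma retr_M_smooth:
  assumes v: "valid_system s"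
  shows "smooth_map (idx2 s) (coord2 s) (idx1 s) (coord1 s) (tangent_bundle s) (\<lambda>(P, \<xi>). retr_M s P \<xi>)"
proof -
  let ?q = "\<lambda>k z. step_power s k (z \<circ> Inl) (z \<circ> Inr)"
  define D where "D = {z \<in> topspace (powertop_real (idx2 s)). \<forall>k\<in>{..<n_stations s}. 0 < ?q k z}"
  have proj: "(\<lambda>z. (z \<circ> Inl) j) \<in> smooth_alg (idx2 s) E" "(\<lambda>z. (z \<circ> Inr) j) \<in> smooth_alg (idx2 s) E"
    if "j \<in> idx1 s" for j E
    using that by (auto simp: idx2_def intro: smooth_alg.proj)
  have "openin (powertop_real (idx2 s)) D"
    unfolding D_def by (intro openin_positive_smooth_alg step_power_smooth_alg proj) auto
  moreover have "coord2 s p \<in> D" if "p \<in> tangent_bundle s" for p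
    using that coord2_in_topspace[of s p] step_power_pos[OF v]
    by (auto simp: D_def tangent_bundle_def coord2_def o_def)
  moreover have "smooth_fun_on (idx2 s) D (\<lambda>z. retr_coord s (z \<circ> Inl) (z \<circ> Inr) j)" if j: "j \<in> idx1 s" for j
    using station_less[OF v j]
    by (intro smooth_alg_smooth_fun_on retr_coord_smooth_alg proj j \<open>openin _ D\<close>) (auto simp: D_def)
  moreover have "coord1 s (retr_M s P \<xi>) j = retr_coord s (coord2 s (P, \<xi>) \<circ> Inl) (coord2 s (P, \<xi>) \<circ> Inr) j"
    if "(P, \<xi>) \<in> tangent_bundle s" "j \<in> idx1 s" for P \<xi> j
    using that bundle_ambient[of P s \<xi>]
    by (simp add: tangent_bundle_def retr_coord_coord1[OF v] coord2_def o_def)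
  ultimately show ?thesis
    unfolding smooth_map_def
    by (intro ballI exI[of _ D] exI[of _ "\<lambda>j z. retr_coord s (z \<circ> Inl) (z \<circ> Inr) j"]) auto
qed

text \<open>At the new foot point the squared group norms are the constants \<open>tx_power\<close>,
  so the projection is polynomial in the retracted coordinates and the coordinates of
  \<open>\<xi>\<close>. Its only roots are those of the retraction, and positivity of the step
  powers again defines the domain.\<close>

lemma transport_smooth:
  assumes v: "valid_system s"
  shows "smooth_map (idx3 s) (coord3 s) (idx2 s) (coord2 s) (whitney_sum s)
    (\<lambda>(P, \<eta>, \<xi>). (retr_M s P \<eta>, proj_formula s (retr_M s P \<eta>) \<xi>))"
proof -
  \<comment> \<open>The coordinates of the foot point, the step and the transported vector inside
    the nested sum of index sets.\<close>
  let ?x = "\<lambda>z j. z (Inl j)" and ?y = "\<lambda>z j. z (Inr (Inl j))" and ?w = "\<lambda>z j. z (Inr (Inr j))"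
  let ?q = "\<lambda>k z. step_power s k (?x z) (?y z)"
  let ?R = "\<lambda>z. retr_coord s (?x z) (?y z)"
  \<comment> \<open>This is \<open>coord1_proj_formula\<close> at the new foot point, with
    \<open>rho_coeff\<close> expanded into coordinates.\<close>
  let ?T = "\<lambda>z j. ?w z j -
    1 / tx_power s (station s j) * station_dot s (station s j) (?R z) (?w z) * ?R z j"
  define G where "G = case_sum (\<lambda>j z. ?R z j) (\<lambda>j z. ?T z j)"
  define D where "D = {z \<in> topspace (powertop_real (idx3 s)). \<forall>k\<in>{..<n_stations s}. 0 < ?q k z}"
  have proj: "(\<lambda>z. ?x z j) \<in> smooth_alg (idx3 s) E" "(\<lambda>z. ?y z j) \<in> smooth_alg (idx3 s) E"
    "(\<lambda>z. ?w z j) \<in> smooth_alg (idx3 s) E" if "j \<in> idx1 s" for j E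
    using that by (auto simp: idx3_def idx2_def intro: smooth_alg.proj)
  have op: "openin (powertop_real (idx3 s)) D"
    unfolding D_def by (intro openin_positive_smooth_alg step_power_smooth_alg proj) auto
  have mem: "coord3 s p \<in> D" if "p \<in> whitney_sum s" for p
    using that coord3_in_topspace[of s p] step_power_pos[OF v]
    by (auto simp: D_def whitney_sum_def coord3_def coord2_def)
  have R: "(\<lambda>z. ?R z j) \<in> smooth_alg (idx3 s) D" if j: "j \<in> idx1 s" for j
    using station_less[OF v j] by (intro retr_coord_smooth_alg proj j) (auto simp: D_def)
  have "(\<lambda>z. ?T z j) \<in> smooth_alg (idx3 s) D" if j: "j \<in> idx1 s" for j
    by (intro smooth_alg_diff smooth_alg.mult smooth_alg.const station_dot_smooth_alg R proj j)
  then have smooth: "smooth_fun_on (idx3 s) D (G j)" if "j \<in> idx2 s" for j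
    using that R by (auto simp: G_def idx2_def intro: smooth_alg_smooth_fun_on[OF op])
  have eq: "coord2 s (retr_M s P \<eta>, proj_formula s (retr_M s P \<eta>) \<xi>) j = G j (coord3 s (P, \<eta>, \<xi>))"
    if p: "(P, \<eta>, \<xi>) \<in> whitney_sum s" and j: "j \<in> idx2 s" for P \<eta> \<xi> j
  proof -
    have amb: "P \<in> ambient s" "\<eta> \<in> ambient s" "\<xi> \<in> ambient s"
      using p bundle_ambient[of P s] by (auto simp: whitney_sum_def)
    note Ramb = retr_M_ambient[OF v amb(1,2)]
    have "rho_coeff s (retr_M s P \<eta>) \<xi> k = 1 / tx_power s k *
        station_dot s k (retr_coord s (coord1 s P) (coord1 s \<eta>)) (coord1 s \<xi>)" if "k < n_stations s" for k
      using rho_coeff_station_dot[OF v that Ramb amb(3)]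
        station_dot_cong[of s "coord1 s (retr_M s P \<eta>)" _ _ "coord1 s \<xi>", OF retr_coord_coord1[OF v amb(1,2)] refl]
      by simp
    then show ?thesis
      using j by (auto simp: idx2_def G_def coord2_def coord3_def station_less[OF v]
          retr_coord_coord1[OF v amb(1,2)] coord1_proj_formula[OF v Ramb amb(3)])
  qed
  show ?thesis
    unfolding smooth_map_def
    by (intro ballI exI[of _ D] exI[of _ G]) (auto simp: op mem smooth eq)
qed

section \<open>Value and differential of the retraction at the zero vector\<close>

lemma retr_M_zero:
  assumes v: "valid_system s" and P: "P \<in> manifold_M s"
  shows "retr_M s P (tup_zero s) = P"
proof (rule ambient_eqI)
  have amb: "P \<in> ambient s" using P by (simp add: manifold_M_def)
  show "retr_M s P (tup_zero s) \<in> ambient s" "P \<in> ambient s"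
    using retr_M_ambient[OF v amb tup_zero_ambient] amb by auto
  fix j assume j: "j \<in> idx1 s"
  have k: "station s j < n_stations s" using v j by (rule station_less)
  have "step_power s (station s j) (coord1 s P) (coord1 s (tup_zero s)) =
      station_dot s (station s j) (coord1 s P) (coord1 s P)"
    unfolding step_power_def by (intro station_dot_cong) (auto simp: coord1_tup_zero)
  also have "\<dots> = tx_power s (station s j)" using P k by (simp add: manifold_iff[OF v])
  finally show "coord1 s (retr_M s P (tup_zero s)) j = coord1 s P j"
    using tx_power_pos[OF v k]
    by (simp add: retr_coord_coord1[OF v amb tup_zero_ambient j] retr_coord_def coord1_tup_zero[OF j])
qed

text \<open>Along the multiples of \<open>\<xi>\<close> the radicand has no linear term in
  \<open>t\<close>, so the scaling factor is stationary at 0 with value 1. The product rule then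
  leaves the derivative of the affine part, the entry of \<open>\<xi>\<close>.\<close>

lemma retr_M_derivative:
  assumes v: "valid_system s" and P: "P \<in> manifold_M s" and \<xi>: "\<xi> \<in> tangent s P"
    and i: "i < n_users s" and r: "r < n_rows s i" and c: "c < n_streams s i"
  shows "((\<lambda>t. retr_M s P (tup_scale t \<xi>) ! i $$ (r, c)) has_vector_derivative \<xi> ! i $$ (r, c)) (at 0)"
proof -
  let ?k = "serving s i ! (r div n_antennas s)"
  define p where "p = tx_power s ?k"
  define q where "q = station_dot s ?k (coord1 s \<xi>) (coord1 s \<xi>)"
  have k: "?k < n_stations s" using v i r by (rule serving_station(3))
  have p: "0 < p" using v k by (simp add: p_def tx_power_pos)
  note amb = bundle_ambient[OF P \<xi>]
  note scale = tup_scale_ambient[OF amb(2)] coord1_tup_scale[OF amb(2)]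
  have dot: "station_dot s l (coord1 s (tup_scale t \<xi>)) y = t * station_dot s l (coord1 s \<xi>) y" for l t y
  proof -
    have "station_dot s l (coord1 s (tup_scale t \<xi>)) y = station_dot s l (\<lambda>j. t * coord1 s \<xi> j) y"
      by (intro station_dot_cong scale refl)
    then show ?thesis using station_dot_scale(1)[of s l "\<lambda>_. t"] by simp
  qed
  have tan: "tup_scale t \<xi> \<in> tangent s P" for t
    using \<xi> by (simp add: tangent_iff[OF v amb(1)] scale dot)
  \<comment> \<open>The scaled vector is tangent again, so Pythagoras applies to it; pulling
    \<open>t\<close> out of each slot of \<open>station_dot\<close> gives
    \<open>t * (t * q)\<close>.\<close>
  have gamma: "gamma_coeff s P (tup_scale t \<xi>) ?k = sqrt p / sqrt (p + t * (t * q))" for t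
    using station_dot_step[OF v P tan k, of t]
    by (simp add: gamma_coeff_station_dot[OF v k amb(1) scale(1)] dot p_def q_def
        station_dot_commute[of s _ "coord1 s \<xi>" "coord1 s (tup_scale t \<xi>)"])
  have "tup_scale t \<xi> ! i $$ (r, c) = complex_of_real t * \<xi> ! i $$ (r, c)" for t
    using ambientD[OF amb(2)] i r c by (simp add: tup_scale_def carrier_matD[OF ambientD(2)[OF amb(2) i]])
  then have eq: "(\<lambda>t. retr_M s P (tup_scale t \<xi>) ! i $$ (r, c)) =
      (\<lambda>t. complex_of_real (sqrt p / sqrt (p + t * (t * q))) *
        (P ! i $$ (r, c) + complex_of_real t * \<xi> ! i $$ (r, c)))"
    by (simp add: retr_M_index[OF v amb(1) scale(1) i r c] gamma)
  have "((\<lambda>t. sqrt p / sqrt (p + t * (t * q))) has_real_derivative 0) (at 0)"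
    using p by (auto intro!: derivative_eq_intros)
  from has_vector_derivative_of_real[OF this, where 'a = complex]
  have g: "((\<lambda>t. complex_of_real (sqrt p / sqrt (p + t * (t * q)))) has_vector_derivative 0) (at 0)"
    by (simp only: of_real_0)
  have l: "((\<lambda>t. P ! i $$ (r, c) + complex_of_real t * \<xi> ! i $$ (r, c)) has_vector_derivative
      \<xi> ! i $$ (r, c)) (at 0)"
    by (auto intro!: derivative_eq_intros)
  show ?thesis
    unfolding eq using has_vector_derivative_mult[OF g l] p by simp
qed

lemma retr_M_retraction:
  assumes "valid_system s"
  shows "is_retraction s (retr_M s)"
  unfolding is_retraction_def
  using assms by (auto intro: retr_M_smooth retr_M_manifold retr_M_zero retr_M_derivative)

section \<open>Conditions on the vector transport\<close>

lemma proj_transport_formula: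
  assumes "valid_system s" "P \<in> manifold_M s" "\<eta> \<in> tangent s P" "\<xi> \<in> tangent s P"
  shows "proj_transport s P \<eta> \<xi> = proj_formula s (retr_M s P \<eta>) \<xi>"
  unfolding proj_transport_def
  using assms by (intro orth_proj_tangent retr_M_manifold) (auto simp: tangent_def)

lemma rho_coeff_lincomb:
  assumes v: "valid_system s" and k: "k < n_stations s"
    and X: "X \<in> ambient s" and \<xi>: "\<xi> \<in> ambient s" and \<zeta>: "\<zeta> \<in> ambient s"
  shows "rho_coeff s X (tup_add (tup_scale a \<xi>) (tup_scale b \<zeta>)) k =
    a * rho_coeff s X \<xi> k + b * rho_coeff s X \<zeta> k"
proof -
  note amb = tup_scale_ambient[OF \<xi>, of a] tup_scale_ambient[OF \<zeta>, of b]
  have "station_dot s k (coord1 s X) (coord1 s (tup_add (tup_scale a \<xi>) (tup_scale b \<zeta>))) =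
      station_dot s k (coord1 s X) (\<lambda>j. a * coord1 s \<xi> j + b * coord1 s \<zeta> j)"
    by (intro station_dot_cong refl) (simp add: coord1_tup_add[OF amb] coord1_tup_scale \<xi> \<zeta>)
  also have "\<dots> = a * station_dot s k (coord1 s X) (coord1 s \<xi>) + b * station_dot s k (coord1 s X) (coord1 s \<zeta>)"
    using station_dot_scale(2)[of s k "coord1 s X" "\<lambda>_. a" "coord1 s \<xi>"]
      station_dot_scale(2)[of s k "coord1 s X" "\<lambda>_. b" "coord1 s \<zeta>"] by (simp add: station_dot_add)
  finally show ?thesis
    by (simp add: rho_coeff_station_dot[OF v k X] \<xi> \<zeta> tup_add_ambient[OF amb] add_divide_distrib)
qed

text \<open>For a fixed foot point \<open>rho_coeff\<close> is linear in the vector, so every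
  coordinate of the formula is linear in it as well.\<close>

lemma proj_formula_lincomb:
  assumes v: "valid_system s"
    and X: "X \<in> ambient s" and \<xi>: "\<xi> \<in> ambient s" and \<zeta>: "\<zeta> \<in> ambient s"
  shows "proj_formula s X (tup_add (tup_scale a \<xi>) (tup_scale b \<zeta>)) =
    tup_add (tup_scale a (proj_formula s X \<xi>)) (tup_scale b (proj_formula s X \<zeta>))"
proof (rule ambient_eqI)
  note amb = tup_scale_ambient[OF \<xi>, of a] tup_scale_ambient[OF \<zeta>, of b]
  note lin = tup_add_ambient[OF amb]
  note pf = proj_formula_ambient[OF v X \<xi>] proj_formula_ambient[OF v X \<zeta>]
  note pamb = tup_scale_ambient[OF pf(1), of a] tup_scale_ambient[OF pf(2), of b]
  show "proj_formula s X (tup_add (tup_scale a \<xi>) (tup_scale b \<zeta>)) \<in> ambient s"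
    using v X lin by (rule proj_formula_ambient)
  show "tup_add (tup_scale a (proj_formula s X \<xi>)) (tup_scale b (proj_formula s X \<zeta>)) \<in> ambient s"
    using pamb by (rule tup_add_ambient)
  fix j assume j: "j \<in> idx1 s"
  show "coord1 s (proj_formula s X (tup_add (tup_scale a \<xi>) (tup_scale b \<zeta>))) j =
      coord1 s (tup_add (tup_scale a (proj_formula s X \<xi>)) (tup_scale b (proj_formula s X \<zeta>))) j"
    using j v X \<xi> \<zeta>
    by (simp add: coord1_proj_formula lin rho_coeff_lincomb station_less coord1_tup_add[OF amb]
        coord1_tup_add[OF pamb] coord1_tup_scale pf algebra_simps)
qed

text \<open>A tangent vector is orthogonal to every group of \<open>P\<close>, so all coefficients
  vanish. Together with \<open>retr_M_zero\<close> this yields the identity for transport along the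
  zero vector.\<close>

lemma proj_formula_of_tangent:
  assumes v: "valid_system s" and P: "P \<in> manifold_M s" and \<xi>: "\<xi> \<in> tangent s P"
  shows "proj_formula s P \<xi> = \<xi>"
proof (rule ambient_eqI)
  note amb = bundle_ambient[OF P \<xi>]
  show "proj_formula s P \<xi> \<in> ambient s" "\<xi> \<in> ambient s"
    using proj_formula_ambient[OF v amb] amb by auto
  fix j assume j: "j \<in> idx1 s"
  have k: "station s j < n_stations s" using v j by (rule station_less)
  have "rho_coeff s P \<xi> (station s j) = 0"
    using \<xi> k station_dot_commute[of s "station s j" "coord1 s P" "coord1 s \<xi>"]
    by (simp add: rho_coeff_station_dot[OF v k amb] tangent_iff[OF v amb(1)])
  then show "coord1 s (proj_formula s P \<xi>) j = coord1 s \<xi> j"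
    by (simp add: coord1_proj_formula[OF v amb j])
qed

text \<open>Makes \<open>proj_transport_formula\<close> applicable to linear combinations; the
  tangency conditions are linear equations.\<close>

lemma tangent_lincomb:
  assumes v: "valid_system s" and P: "P \<in> manifold_M s" and \<xi>: "\<xi> \<in> tangent s P" and \<zeta>: "\<zeta> \<in> tangent s P"
  shows "tup_add (tup_scale a \<xi>) (tup_scale b \<zeta>) \<in> tangent s P"
proof -
  note amb = bundle_ambient[OF P \<xi>] bundle_ambient(2)[OF P \<zeta>]
  note samb = tup_scale_ambient[OF amb(2), of a] tup_scale_ambient[OF amb(3), of b]
  have "station_dot s k (coord1 s (tup_add (tup_scale a \<xi>) (tup_scale b \<zeta>))) (coord1 s P) =
      a * station_dot s k (coord1 s \<xi>) (coord1 s P) + b * station_dot s k (coord1 s \<zeta>) (coord1 s P)" for k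
  proof -
    have "station_dot s k (coord1 s (tup_add (tup_scale a \<xi>) (tup_scale b \<zeta>))) (coord1 s P) =
        station_dot s k (\<lambda>j. a * coord1 s \<xi> j + b * coord1 s \<zeta> j) (coord1 s P)"
      by (intro station_dot_cong refl) (simp add: coord1_tup_add[OF samb] coord1_tup_scale amb)
    then show ?thesis
      using station_dot_scale(1)[of s k "\<lambda>_. a" "coord1 s \<xi>"] station_dot_scale(1)[of s k "\<lambda>_. b" "coord1 s \<zeta>"]
      by (simp add: station_dot_add)
  qed
  then show ?thesis
    using \<xi> \<zeta> tup_add_ambient[OF samb] by (simp add: tangent_iff[OF v amb(1)])
qed

lemma tup_zero_tangent:
  assumes v: "valid_system s" and P: "P \<in> manifold_M s"
  shows "tup_zero s \<in> tangent s P"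
proof -
  have "P \<in> ambient s" using P by (simp add: manifold_M_def)
  moreover have "station_dot s k (coord1 s (tup_zero s)) y = 0" for k y
    unfolding station_dot_def by (intro sum.neutral) (auto simp: coord1_tup_zero)
  ultimately show ?thesis by (simp add: tangent_iff[OF v] tup_zero_ambient)
qed

text \<open>Smoothness along \<open>S\<close> tests the map at points of \<open>S\<close> only. This
  carries it from the closed formula to \<open>proj_transport\<close>, the two agreeing on the
  Whitney sum.\<close>

lemma smooth_map_cong:
  assumes "smooth_map I \<phi> J \<psi> S F" "\<And>p. p \<in> S \<Longrightarrow> F p = F' p"
  shows "smooth_map I \<phi> J \<psi> S F'"
  using assms unfolding smooth_map_def by simp

lemma proj_transport_vector_transport:
  assumes v: "valid_system s"
  shows "is_vector_transport s (retr_M s) (proj_transport s)"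
  unfolding is_vector_transport_def
proof (intro conjI ballI allI)
  show "is_retraction s (retr_M s)" using v by (rule retr_M_retraction)
  show "smooth_map (idx3 s) (coord3 s) (idx2 s) (coord2 s) (whitney_sum s)
      (\<lambda>(P, \<eta>, \<xi>). (retr_M s P \<eta>, proj_transport s P \<eta> \<xi>))"
    by (rule smooth_map_cong[OF transport_smooth[OF v]])
      (auto simp: whitney_sum_def proj_transport_formula[OF v])
next
  fix P \<eta> \<xi> assume "P \<in> manifold_M s" "\<eta> \<in> tangent s P" "\<xi> \<in> tangent s P"
  then show "proj_transport s P \<eta> \<xi> \<in> tangent s (retr_M s P \<eta>)"
    by (simp add: proj_transport_formula[OF v] proj_formula_tangent[OF v] retr_M_manifold[OF v] bundle_ambient(2))
next
  fix P \<xi> assume "P \<in> manifold_M s" "\<xi> \<in> tangent s P"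
  then show "proj_transport s P (tup_zero s) \<xi> = \<xi>"
    by (simp add: proj_transport_formula[OF v] tup_zero_tangent[OF v] retr_M_zero[OF v] proj_formula_of_tangent[OF v])
next
  fix P \<eta> \<xi> \<zeta> a b
  assume *: "P \<in> manifold_M s" "\<eta> \<in> tangent s P" "\<xi> \<in> tangent s P" "\<zeta> \<in> tangent s P"
  then have "retr_M s P \<eta> \<in> ambient s" "\<xi> \<in> ambient s" "\<zeta> \<in> ambient s"
    using bundle_ambient retr_M_ambient[OF v] by blast+
  then show "proj_transport s P \<eta> (tup_add (tup_scale a \<xi>) (tup_scale b \<zeta>)) =
      tup_add (tup_scale a (proj_transport s P \<eta> \<xi>)) (tup_scale b (proj_transport s P \<eta> \<zeta>))"
    using * by (simp add: proj_transport_formula[OF v] tangent_lincomb[OF v] proj_formula_lincomb[OF v])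
qed

theorem theorem4:
  fixes s :: mimo_system
  assumes "valid_system s"
  shows "is_vector_transport s (retr_M s) (proj_transport s) \<and>
    (\<forall>P\<in>manifold_M s. \<forall>\<eta>\<in>tangent s P. \<forall>\<xi>\<in>tangent s P. \<forall>Pnew. Pnew = retr_M s P \<eta> \<longrightarrow>
       proj_transport s P \<eta> \<xi> =
         map (\<lambda>i. \<xi> ! i - finsum (module_mat TYPE(complex) (n_rows s i) (n_streams s i))
                (\<lambda>l. complex_of_real (rho_coeff s Pnew \<xi> l) \<cdot>\<^sub>m (WQW s i l * Pnew ! i))
                (set (serving s i)))
           [0..<n_users s])"
  using proj_transport_vector_transport[OF assms] proj_transport_formula[OF assms]
  by (simp add: proj_formula_def)

end
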